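(* There exists a sequence $\{b_n\}\subset\Lambda_{x,y}(\alpha)$ such that, for every $\theta\in[0,2\pi)$, $$\lim_{n\to\infty}c^*(\theta;b_n)=\lim_{n\to\infty}w(\theta;b_n)=+\infty.$$
   Context: Fix $L_1,L_2>0$ and $\alpha>0$. $\Lambda_{x,y}(\alpha)$ is the set of $b\in C^1(\mathbb R^2)$ with $b\ge0$, $b(x+L_1,y)=b(x,y+L_2)=b(x,y)$, and $\int_0^{L_1}\int_0^{L_2}b\,dy\,dx=\alpha L_1L_2$. For $b\in\Lambda_{x,y}(\alpha)$, $\lambda\in\mathbb R$, and $\theta\in[0,2\pi)$, let $\mu(\lambda,\theta,b)$ be the principal eigenvalue of $$-u_{xx}-u_{yy}+2\lambda\cos\theta\,u_x+2\lambda\sin\theta\,u_y-b(x,y)u=\mu u$$ with $u$ being $(L_1,L_2)$-periodic. Define $$c^*(\theta;b)=\inf\{c>0:\exists\lambda>0,\ \mu(\lambda,\theta,b)=\lambda^2-\lambda c\}$$ (this is the minimal speed of travelling waves in direction $\theta$ of $u_t=u_{xx}+u_{yy}+b(x,y)f(u)+g(u)$ with $f'(0)=1$), and $$w(\theta;b)=\min_{|\theta-\phi|<\pi/2}\frac{c^*(\phi;b)}{\cos(\theta-\phi)}$$ (the spreading speed). *)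

theory Defs
  imports "HOL-Analysis.Analysis" "HOL-Library.Extended_Real"
begin

definition pdx :: "(real \<Rightarrow> real \<Rightarrow> real) \<Rightarrow> real \<Rightarrow> real \<Rightarrow> real" where
  "pdx f x y = deriv (\<lambda>s. f s y) x"

definition pdy :: "(real \<Rightarrow> real \<Rightarrow> real) \<Rightarrow> real \<Rightarrow> real \<Rightarrow> real" where
  "pdy f x y = deriv (\<lambda>t. f x t) y"

definition cont2 :: "(real \<Rightarrow> real \<Rightarrow> real) \<Rightarrow> bool" where
  "cont2 f \<longleftrightarrow> continuous_on UNIV (\<lambda>p. f (fst p) (snd p))"

definition C1_plane :: "(real \<Rightarrow> real \<Rightarrow> real) \<Rightarrow> bool" where
  "C1_plane f \<longleftrightarrow> cont2 f \<and>
     (\<forall>x y. (\<lambda>s. f s y) differentiable (at x) \<and> (\<lambda>t. f x t) differentiable (at y)) \<and>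
     cont2 (pdx f) \<and> cont2 (pdy f)"

definition C2_plane :: "(real \<Rightarrow> real \<Rightarrow> real) \<Rightarrow> bool" where
  "C2_plane f \<longleftrightarrow> C1_plane f \<and> C1_plane (pdx f) \<and> C1_plane (pdy f)"

definition periodic2 :: "real \<Rightarrow> real \<Rightarrow> (real \<Rightarrow> real \<Rightarrow> real) \<Rightarrow> bool" where
  "periodic2 L1 L2 f \<longleftrightarrow> (\<forall>x y. f (x + L1) y = f x y \<and> f x (y + L2) = f x y)"

definition Lambda_xy :: "real \<Rightarrow> real \<Rightarrow> real \<Rightarrow> (real \<Rightarrow> real \<Rightarrow> real) set" where
  "Lambda_xy L1 L2 \<alpha> = {b. C1_plane b \<and> (\<forall>x y. b x y \<ge> 0) \<and> periodic2 L1 L2 b \<and>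
      integral (cbox (0,0) (L1,L2)) (\<lambda>p. b (fst p) (snd p)) = \<alpha> * L1 * L2}"

definition is_principal_eig ::
  "real \<Rightarrow> real \<Rightarrow> real \<Rightarrow> real \<Rightarrow> (real \<Rightarrow> real \<Rightarrow> real) \<Rightarrow> real \<Rightarrow> bool" where
  "is_principal_eig L1 L2 lam \<theta> b \<mu> \<longleftrightarrow>
     (\<exists>u. C2_plane u \<and> periodic2 L1 L2 u \<and> (\<forall>x y. u x y > 0) \<and>
        (\<forall>x y. - pdx (pdx u) x y - pdy (pdy u) x y + 2 * lam * cos \<theta> * pdx u x y
               + 2 * lam * sin \<theta> * pdy u x y - b x y * u x y = \<mu> * u x y))"

definition princ_eig :: "real \<Rightarrow> real \<Rightarrow> real \<Rightarrow> real \<Rightarrow> (real \<Rightarrow> real \<Rightarrow> real) \<Rightarrow> real" where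
  "princ_eig L1 L2 lam \<theta> b = (THE \<mu>. is_principal_eig L1 L2 lam \<theta> b \<mu>)"

text \<open>Minimal wave speed, as an extended real (infimum of the empty set is +infinity).\<close>
definition cstar :: "real \<Rightarrow> real \<Rightarrow> real \<Rightarrow> (real \<Rightarrow> real \<Rightarrow> real) \<Rightarrow> ereal" where
  "cstar L1 L2 \<theta> b = Inf (ereal ` {c. c > 0 \<and>
      (\<exists>lam>0. princ_eig L1 L2 lam \<theta> b = lam\<^sup>2 - lam * c)})"

text \<open>Spreading speed (Freidlin--Gartner formula); the minimum is written as an infimum.\<close>
definition wspeed :: "real \<Rightarrow> real \<Rightarrow> real \<Rightarrow> (real \<Rightarrow> real \<Rightarrow> real) \<Rightarrow> ereal" where
  "wspeed L1 L2 \<theta> b = Inf ((\<lambda>\<phi>. cstar L1 L2 \<phi> b / ereal (cos (\<theta> - \<phi>))) `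
      {\<phi>. \<bar>\<theta> - \<phi>\<bar> < pi / 2})"

end

theory Submission
  imports Defs "HOL-Complex_Analysis.Great_Picard"
begin

text \<open>Let \<open>\<mu>(\<lambda>)\<close> be the principal eigenvalue. A speed \<open>c\<close> in the set defining \<open>c\<^sup>*\<close> satisfies
  \<open>\<lambda> c = \<lambda>\<^sup>2 - \<mu>(\<lambda>)\<close>, and \<open>\<mu>(\<lambda>) \<le> 0\<close> gives \<open>c \<ge> \<lambda>\<close>, so \<open>c\<^sup>2 \<ge> \<lambda>\<^sup>2 - \<mu>(\<lambda>)\<close>. For every \<open>\<lambda>\<close>, \<open>\<theta>\<close> and
  every periodic \<open>\<phi>\<close>, \<open>(\<lambda>\<^sup>2 - \<mu>(\<lambda>)) \<integral>\<phi>\<^sup>2 \<ge> \<integral>b \<phi>\<^sup>2 - \<integral>|\<nabla>\<phi>|\<^sup>2\<close>. Points have zero capacity in the plane, so there are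
  \<open>\<phi>\<close> with \<open>\<integral>\<phi>\<^sup>2 + \<integral>|\<nabla>\<phi>|\<^sup>2 = O(\<phi>(0))\<close> and \<open>\<phi>(0)\<close> as large as desired; taking for \<open>b\<close> a high power of a
  trigonometric polynomial that peaks at the origin makes the right-hand side of order \<open>\<phi>(0)\<^sup>2\<close>.

  The principal eigenvalue is introduced by a definite description, so its existence matters. For
  trigonometric polynomials \<open>b\<close>, the eigenvalue is \<open>1 - s\<close> for the largest \<open>s\<close> that admits a nonnegative
  \<open>u \<noteq> 0\<close> with \<open>u \<le> (-\<Delta> + 2\<lambda>e\<cdot>\<nabla> + s)\<^sup>-\<^sup>1 ((b + 1) u)\<close>. The supremum is attained because the coefficients of a
  nonnegative Fourier series are bounded by its mean, and the strong maximum principle forces equality at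
  the supremum.\<close>

section \<open>Maximum principles\<close>

text \<open>The drift makes the operator non-self-adjoint, so it has no Rayleigh quotient; the
  positive eigenfunction supplies a substitute whose lower bound is free of lambda and of the
  direction. This uniformity is decisive: one \<open>b\<close> must serve all directions, since the
  spreading speed is an infimum over a half-circle of them. The exponent of the peak depends on the
  test function, which depends only on the target and on \<alpha>. A normalising factor restores the
  mean \<alpha>. The gain is quadratic and the cost linear in the value at the origin, so the bound
  grows like 2 \<alpha> times that value. Trigonometric polynomials are chosen because
  multiplication by one acts on Fourier coefficients through finitely many shifts: it preserves
  polynomial decay and is continuous coefficient by coefficient. Compactness becomes a diagonal
  argument, and elliptic regularity becomes division by a symbol. The shift to \<open>b + 1\<close>
  makes the zeroth order coefficient at least 1, so that the constant function starts the supremum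
  at \<open>s = 1\<close>.\<close>

lemma local_min_derivatives:
  fixes g g' :: "real \<Rightarrow> real"
  assumes g: "\<And>s. (g has_real_derivative g' s) (at s)"
    and g': "(g' has_real_derivative l) (at x)"
    and "e > 0" and min: "\<And>s. \<bar>s - x\<bar> < e \<Longrightarrow> g x \<le> g s"
  shows "g' x = 0" and "l \<ge> 0"
proof -
  show zero: "g' x = 0"
    by (rule DERIV_local_min[OF g[of x] \<open>e > 0\<close>]) (use min in \<open>auto simp: abs_minus_commute\<close>)
  show "l \<ge> 0"
  proof (rule ccontr)
    assume "\<not> l \<ge> 0"
    then obtain d where "d > 0" and d: "\<And>h. 0 < h \<Longrightarrow> h < d \<Longrightarrow> g' x > g' (x + h)"
      using DERIV_neg_dec_right[OF g'] by (auto simp: not_le)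
    define h where "h = min d e / 2"
    have h: "0 < h" "h < d" "h < e"
      using \<open>d > 0\<close> \<open>e > 0\<close> by (auto simp: h_def min_def)
    obtain z where z: "x < z" "z < x + h" "g (x + h) - g x = (x + h - x) * g' z"
      using MVT2[of x "x + h" g g'] h g by auto
    have "g' z < 0"
      using d[of "z - x"] z h zero by auto
    then have "g (x + h) < g x"
      using z h using mult_pos_neg[of h "g' z"] by simp
    with min[of "x + h"] h show False
      by auto
  qed
qed

text \<open>Pure second derivatives suffice because the equations contain no mixed ones. Explicit
  functions in place of \<open>deriv\<close> let barriers and differences be inserted by
  formula.\<close>

definition jet2 :: "(real \<Rightarrow> real \<Rightarrow> real) \<Rightarrow> (real \<Rightarrow> real \<Rightarrow> real) \<Rightarrow> (real \<Rightarrow> real \<Rightarrow> real) \<Rightarrow>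
    (real \<Rightarrow> real \<Rightarrow> real) \<Rightarrow> (real \<Rightarrow> real \<Rightarrow> real) \<Rightarrow> bool" where
  "jet2 f fx fy fxx fyy \<longleftrightarrow> (\<forall>x y.
     ((\<lambda>s. f s y) has_real_derivative fx x y) (at x) \<and>
     ((\<lambda>t. f x t) has_real_derivative fy x y) (at y) \<and>
     ((\<lambda>s. fx s y) has_real_derivative fxx x y) (at x) \<and>
     ((\<lambda>t. fy x t) has_real_derivative fyy x y) (at y))"

lemma jet2_diff:
  assumes "jet2 f fx fy fxx fyy" and "jet2 g gx gy gxx gyy"
  shows "jet2 (\<lambda>x y. f x y - g x y) (\<lambda>x y. fx x y - gx x y) (\<lambda>x y. fy x y - gy x y)
    (\<lambda>x y. fxx x y - gxx x y) (\<lambda>x y. fyy x y - gyy x y)"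
  using assms unfolding jet2_def by (auto intro!: derivative_intros)

lemma jet2_cmult:
  assumes "jet2 f fx fy fxx fyy"
  shows "jet2 (\<lambda>x y. c * f x y) (\<lambda>x y. c * fx x y) (\<lambda>x y. c * fy x y)
    (\<lambda>x y. c * fxx x y) (\<lambda>x y. c * fyy x y)"
  using assms unfolding jet2_def by (auto intro!: DERIV_cmult)

lemma jet2_local_min:
  assumes "jet2 f fx fy fxx fyy" and "e > 0"
    and min: "\<And>s t. \<bar>s - x\<bar> < e \<Longrightarrow> \<bar>t - y\<bar> < e \<Longrightarrow> f x y \<le> f s t"
  shows "fx x y = 0" "fy x y = 0" "fxx x y \<ge> 0" "fyy x y \<ge> 0"
proof -
  note d = assms(1)[unfolded jet2_def, rule_format]
  show "fx x y = 0" "fxx x y \<ge> 0"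
    using local_min_derivatives[of "\<lambda>s. f s y" "\<lambda>s. fx s y" "fxx x y" x e] d \<open>e > 0\<close> min[of _ y]
    by auto
  show "fy x y = 0" "fyy x y \<ge> 0"
    using local_min_derivatives[of "\<lambda>t. f x t" "\<lambda>t. fy x t" "fyy x y" y e] d \<open>e > 0\<close> min[of x]
    by auto
qed

lemma C2_plane_jet2:
  assumes "C2_plane u"
  shows "jet2 u (pdx u) (pdy u) (pdx (pdx u)) (pdy (pdy u))"
  using assms unfolding jet2_def C2_plane_def C1_plane_def pdx_def pdy_def
  by (auto simp: DERIV_deriv_iff_real_differentiable)

lemma periodic2_shift:
  assumes "periodic2 L1 L2 f"
  shows "f (x + of_int m * L1) (y + of_int n * L2) = f x y"
proof -
  have per: "g (z + of_int k * L) = g z" if "\<And>z. g (z + L) = g z" for g :: "real \<Rightarrow> real" and z L k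
  proof (induction k rule: int_induct[where k = 0])
    case (step1 i)
    then show ?case using that[of "z + of_int i * L"] by (simp add: algebra_simps)
  next
    case (step2 i)
    then show ?case using that[of "z + of_int (i - 1) * L"] by (simp add: algebra_simps)
  qed simp
  have "f (x + of_int m * L1) (y + of_int n * L2) = f x (y + of_int n * L2)"
    using per[of "\<lambda>s. f s (y + of_int n * L2)" L1 x m] assms by (simp add: periodic2_def)
  also have "\<dots> = f x y"
    using per[of "\<lambda>t. f x t" L2 y n] assms by (simp add: periodic2_def)
  finally show ?thesis .
qed

lemma period_reduce:
  fixes L x :: real
  assumes "L > 0"
  obtains m :: int where "x + of_int m * L \<in> {0..L}"
proof
  have "of_int \<lfloor>x / L\<rfloor> \<le> x / L" "x / L \<le> of_int \<lfloor>x / L\<rfloor> + 1"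
    by linarith+
  then have "of_int \<lfloor>x / L\<rfloor> * L \<le> x" "x \<le> (of_int \<lfloor>x / L\<rfloor> + 1) * L"
    using assms by (simp_all only: pos_le_divide_eq pos_divide_le_eq)
  then show "x + of_int (- \<lfloor>x / L\<rfloor>) * L \<in> {0..L}"
    by (simp add: algebra_simps)
qed

lemma periodic2_attains_min:
  assumes "L1 > 0" "L2 > 0" "cont2 f" "periodic2 L1 L2 f"
  shows "\<exists>x0 y0. \<forall>x y. f x0 y0 \<le> f x y"
proof -
  have "compact (cbox (0, 0) (L1, L2))"
    by (rule compact_cbox)
  moreover have "cbox (0, 0) (L1, L2) \<noteq> {}"
    using assms(1,2) by (simp add: cbox_Pair_eq)
  moreover have "continuous_on (cbox (0, 0) (L1, L2)) (\<lambda>p. f (fst p) (snd p))"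
    using assms(3) continuous_on_subset unfolding cont2_def by blast
  ultimately obtain p where p: "\<forall>q \<in> cbox (0,0) (L1,L2). f (fst p) (snd p) \<le> f (fst q) (snd q)"
    using continuous_attains_inf[of "cbox (0, 0) (L1, L2)" "\<lambda>p. f (fst p) (snd p)"] by blast
  show ?thesis
  proof (intro exI allI)
    fix x y
    obtain m n :: int where "x + of_int m * L1 \<in> {0..L1}" "y + of_int n * L2 \<in> {0..L2}"
      using period_reduce assms by metis
    then show "f (fst p) (snd p) \<le> f x y"
      using bspec[OF p, of "(x + of_int m * L1, y + of_int n * L2)"] periodic2_shift[OF assms(4), of x m y n]
      by (auto simp: cbox_Pair_eq)
  qed
qed

text \<open>At a global minimum, which exists by periodicity, the gradient vanishes and the second
  derivatives are nonnegative, so the inequality leaves \<open>s * f\<close> nonnegative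
  there.\<close>

lemma weak_maximum_principle:
  assumes "L1 > 0" "L2 > 0" "cont2 f" "periodic2 L1 L2 f" and j: "jet2 f fx fy fxx fyy" and "s > 0"
    and sup: "\<And>x y. - fxx x y - fyy x y + a * fx x y + c * fy x y + s * f x y \<ge> 0"
  shows "f x y \<ge> 0"
proof -
  obtain x0 y0 where min: "\<And>x y. f x0 y0 \<le> f x y"
    using periodic2_attains_min[OF assms(1-4)] by blast
  note d = jet2_local_min[OF j zero_less_one, of x0 y0, OF min]
  have "s * f x0 y0 \<ge> 0"
    using sup[of x0 y0] d by simp
  then have "f x0 y0 \<ge> 0"
    using \<open>s > 0\<close> by (simp add: zero_le_mult_iff)
  then show ?thesis
    using min[of x y] by simp
qed

lemma gaussian_jet2:
  fixes \<gamma> q1 q2 :: real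
  defines "g \<equiv> \<lambda>x y. exp (- \<gamma> * ((x - q1)\<^sup>2 + (y - q2)\<^sup>2))"
  shows "jet2 g (\<lambda>x y. - 2 * \<gamma> * (x - q1) * g x y) (\<lambda>x y. - 2 * \<gamma> * (y - q2) * g x y)
    (\<lambda>x y. (4 * \<gamma>\<^sup>2 * (x - q1)\<^sup>2 - 2 * \<gamma>) * g x y) (\<lambda>x y. (4 * \<gamma>\<^sup>2 * (y - q2)\<^sup>2 - 2 * \<gamma>) * g x y)"
  unfolding jet2_def g_def
  by (intro allI conjI; (rule derivative_eq_intros refl)+; simp add: power2_eq_square algebra_simps)

text \<open>Hopf's barrier: a Gaussian centred at a point of positivity lies below \<open>f\<close> on an annulus
  reaching any prescribed point.\<close>

lemma strong_maximum_principle: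
  assumes "cont2 f" and j: "jet2 f fx fy fxx fyy" and "s > 0"
    and sup: "\<And>x y. - fxx x y - fyy x y + a * fx x y + c * fy x y + s * f x y \<ge> 0"
    and nonneg: "\<And>x y. f x y \<ge> 0" and pos: "f q1 q2 > 0"
  shows "f p1 p2 > 0"
proof -
  define Q where "Q x y = (x - q1)\<^sup>2 + (y - q2)\<^sup>2" for x y :: real
  define m where "m = f q1 q2 / 2"
  have "m > 0" using pos by (simp add: m_def)
  have Q_dist: "dist (x, y) (q1, q2) = sqrt (Q x y)" for x y
    by (simp add: dist_prod_def Q_def dist_real_def)
  have Q_nonneg: "Q x y \<ge> 0" for x y
    by (simp add: Q_def)
  obtain r where "r > 0" and r: "\<And>x y. Q x y \<le> r\<^sup>2 \<Longrightarrow> f x y \<ge> m"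
  proof -
    have "continuous_on UNIV (\<lambda>p. f (fst p) (snd p))"
      using assms(1) by (simp add: cont2_def)
    then obtain d where "d > 0"
      and d: "\<And>p. dist p (q1, q2) < d \<Longrightarrow> dist (f (fst p) (snd p)) (f q1 q2) < m"
      using \<open>m > 0\<close> unfolding continuous_on_iff by (metis UNIV_I fst_conv snd_conv)
    show thesis
    proof
      show "d / 2 > 0" using \<open>d > 0\<close> by simp
      fix x y assume "Q x y \<le> (d / 2)\<^sup>2"
      then have "sqrt (Q x y) \<le> d / 2"
        using \<open>d > 0\<close> real_le_lsqrt[of "d / 2" "Q x y"] by simp
      then have "dist (x, y) (q1, q2) < d"
        using \<open>d > 0\<close> by (simp add: Q_dist)
      from d[OF this] show "f x y \<ge> m"
        by (auto simp: dist_real_def m_def abs_if split: if_splits)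
    qed
  qed
  \<comment> \<open>The extra 1 puts the target point strictly inside the outer circle, where the
    Gaussian exceeds its boundary value \<open>E\<close>.\<close>
  define R where "R = sqrt (Q p1 p2) + 1"
  have "R > 0" using Q_nonneg[of p1 p2] real_sqrt_ge_zero[of "Q p1 p2"] by (simp add: R_def add_nonneg_pos)
  have pR: "Q p1 p2 < R\<^sup>2"
    using Q_nonneg[of p1 p2] real_sqrt_ge_zero[of "Q p1 p2"]
    by (simp add: R_def power2_sum add_pos_nonneg)
  \<comment> \<open>The operator maps \<open>g\<close> to \<open>-g\<close> times \<open>4 *
    \<gamma>\<^sup>2 * Q - 4 * \<gamma> + 2 * \<gamma> * drift - s\<close>. Within distance
    \<open>R\<close>, and for \<gamma> at least 1, \<gamma> times \<open>D\<close> dominates the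
    last three terms; \<gamma> is taken so large that the first term wins wherever \<open>Q\<close>
    is at least \<open>r\<^sup>2\<close>. Hence \<open>g\<close> is a subsolution on the
    annulus.\<close>
  define D where "D = 4 + 2 * (\<bar>a\<bar> + \<bar>c\<bar>) * R + s"
  define \<gamma> where "\<gamma> = D / (4 * r\<^sup>2) + 1"
  have "D \<ge> 0" using \<open>R > 0\<close> \<open>s > 0\<close> by (simp add: D_def)
  then have "\<gamma> \<ge> 1" by (simp add: \<gamma>_def)
  have \<gamma>: "4 * \<gamma> * r\<^sup>2 \<ge> D"
    using \<open>r > 0\<close> by (simp add: \<gamma>_def field_simps)
  define g where "g x y = exp (- \<gamma> * ((x - q1)\<^sup>2 + (y - q2)\<^sup>2))" for x y
  define E where "E = exp (- \<gamma> * R\<^sup>2)"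
  define v where "v x y = f x y - m * (g x y - E)" for x y
  have gQ: "g x y = exp (- \<gamma> * Q x y)" for x y
    by (simp add: g_def Q_def)
  note jg = gaussian_jet2[of \<gamma> q1 q2, folded g_def[abs_def]]
  have jE: "jet2 (\<lambda>x y. E) (\<lambda>x y. 0) (\<lambda>x y. 0) (\<lambda>x y. 0) (\<lambda>x y. 0)"
    by (simp add: jet2_def)
  note jv = jet2_diff[OF j jet2_cmult[OF jet2_diff[OF jg jE], of m], folded v_def[abs_def]]
  have cont_v: "continuous_on UNIV (\<lambda>p. v (fst p) (snd p))"
    using assms(1) unfolding v_def g_def cont2_def by (intro continuous_intros) auto
  define K where "K = cball (q1, q2) R"
  have K_iff: "(x, y) \<in> K \<longleftrightarrow> Q x y \<le> R\<^sup>2" for x y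
  proof -
    have "(x, y) \<in> K \<longleftrightarrow> sqrt (Q x y) \<le> R"
      by (simp add: K_def Q_dist[symmetric] dist_commute)
    also have "\<dots> \<longleftrightarrow> Q x y \<le> R\<^sup>2"
      using \<open>R > 0\<close> by (metis Q_nonneg less_imp_le real_sqrt_le_iff real_sqrt_unique)
    finally show ?thesis .
  qed
  have "compact K" "K \<noteq> {}" using \<open>R > 0\<close> by (auto simp: K_def)
  then have "\<exists>z\<in>K. \<forall>w\<in>K. v (fst z) (snd z) \<le> v (fst w) (snd w)"
    using continuous_on_subset[OF cont_v subset_UNIV] by (rule continuous_attains_inf)
  then obtain z where "z \<in> K" and z: "\<And>w. w \<in> K \<Longrightarrow> v (fst z) (snd z) \<le> v (fst w) (snd w)"
    by blast
  obtain x y where zxy: "z = (x, y)" by (cases z)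
  \<comment> \<open>A negative minimum lies neither in the inner disc, where \<open>f\<close> is at
    least \<open>m\<close>, nor on the outer circle, where \<open>g = E\<close>. In the open annulus
    the operator applied to \<open>v\<close> would be at most \<open>s * v < 0\<close> at the
    minimum, yet it is nonnegative because \<open>g\<close> is a subsolution.\<close>
  have "v x y \<ge> 0"
  proof (rule ccontr)
    assume neg: "\<not> v x y \<ge> 0"
    have "g x y \<le> 1"
      using \<open>\<gamma> \<ge> 1\<close> Q_nonneg[of x y] by (simp add: gQ)
    then have gE: "g x y - E \<le> 1"
      using exp_gt_zero[of "- \<gamma> * R\<^sup>2"] unfolding E_def by linarith
    have "\<not> Q x y \<le> r\<^sup>2"
    proof
      assume "Q x y \<le> r\<^sup>2"
      then have "f x y \<ge> m" by (rule r)
      moreover have "m * (g x y - E) \<le> m"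
        using gE \<open>m > 0\<close> by simp
      ultimately show False using neg by (simp add: v_def)
    qed
    then have Qr: "Q x y \<ge> r\<^sup>2" by simp
    have "Q x y \<noteq> R\<^sup>2"
      using neg nonneg[of x y] by (auto simp: v_def gQ E_def)
    then have QR: "Q x y < R\<^sup>2"
      using \<open>z \<in> K\<close> K_iff zxy by fastforce
    then have "sqrt (Q x y) < R"
      using \<open>R > 0\<close> by (metis less_imp_le real_sqrt_less_iff real_sqrt_unique)
    then have "(x, y) \<in> ball (q1, q2) R"
      by (simp add: Q_dist[symmetric] dist_commute)
    then obtain e where "e > 0" and e: "ball (x, y) e \<subseteq> ball (q1, q2) R"
      using openE[OF open_ball] by blast
    have near: "v x y \<le> v s t" if "\<bar>s - x\<bar> < e / 2" "\<bar>t - y\<bar> < e / 2" for s t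
    proof -
      have "dist (x, y) (s, t) \<le> \<bar>x - s\<bar> + \<bar>y - t\<bar>"
        by (simp add: dist_prod_def dist_real_def sqrt_sum_squares_le_sum_abs)
      also have "\<dots> < e" using that by (simp add: abs_minus_commute)
      finally have "(s, t) \<in> K"
        using e by (auto simp: K_def)
      then show ?thesis using z zxy by auto
    qed
    note d = jet2_local_min[OF jv half_gt_zero[OF \<open>e > 0\<close>], of x y, OF near]
    have d': "a * (fx x y - m * (- 2 * \<gamma> * (x - q1) * g x y - 0)) = 0"
      "c * (fy x y - m * (- 2 * \<gamma> * (y - q2) * g x y - 0)) = 0"
      "fxx x y - m * ((4 * \<gamma>\<^sup>2 * (x - q1)\<^sup>2 - 2 * \<gamma>) * g x y - 0) \<ge> 0"
      "fyy x y - m * ((4 * \<gamma>\<^sup>2 * (y - q2)\<^sup>2 - 2 * \<gamma>) * g x y - 0) \<ge> 0"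
      using d by (simp_all add: g_def)
    have X: "\<bar>x - q1\<bar> \<le> R" "\<bar>y - q2\<bar> \<le> R"
      using QR \<open>R > 0\<close> abs_le_square_iff[of "x - q1" R] abs_le_square_iff[of "y - q2" R]
        zero_le_power2[of "x - q1"] zero_le_power2[of "y - q2"] unfolding Q_def by linarith+
    have drift: "\<bar>a * (x - q1) + c * (y - q2)\<bar> \<le> (\<bar>a\<bar> + \<bar>c\<bar>) * R"
    proof -
      have "\<bar>a * (x - q1) + c * (y - q2)\<bar> \<le> \<bar>a\<bar> * \<bar>x - q1\<bar> + \<bar>c\<bar> * \<bar>y - q2\<bar>"
        by (metis abs_mult abs_triangle_ineq)
      also have "\<dots> \<le> \<bar>a\<bar> * R + \<bar>c\<bar> * R"
        using X by (intro add_mono mult_left_mono) auto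
      finally show ?thesis by (simp add: algebra_simps)
    qed
    have "\<gamma> * D \<le> \<gamma> * (4 * \<gamma> * Q x y)"
    proof -
      have "4 * \<gamma> * r\<^sup>2 \<le> 4 * \<gamma> * Q x y"
        using Qr \<open>\<gamma> \<ge> 1\<close> by simp
      with \<gamma> have "D \<le> 4 * \<gamma> * Q x y" by linarith
      then show ?thesis
        using \<open>\<gamma> \<ge> 1\<close> by (intro mult_left_mono) auto
    qed
    have "\<gamma> * D \<ge> 4 * \<gamma> + 2 * \<gamma> * \<bar>a * (x - q1) + c * (y - q2)\<bar> + s"
    proof -
      have "\<gamma> * s \<ge> s" using \<open>\<gamma> \<ge> 1\<close> \<open>s > 0\<close> by simp
      moreover have "\<gamma> * \<bar>a * (x - q1) + c * (y - q2)\<bar> \<le> \<gamma> * ((\<bar>a\<bar> + \<bar>c\<bar>) * R)"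
        using drift \<open>\<gamma> \<ge> 1\<close> by (intro mult_left_mono) auto
      ultimately show ?thesis
        by (simp add: D_def algebra_simps)
    qed
    have "4 * \<gamma>\<^sup>2 * Q x y - 4 * \<gamma> + 2 * \<gamma> * (a * (x - q1) + c * (y - q2)) - s \<ge> 0"
    proof -
      have "- (\<gamma> * (a * (x - q1) + c * (y - q2))) \<le> \<bar>\<gamma> * (a * (x - q1) + c * (y - q2))\<bar>"
        by (rule abs_ge_minus_self)
      also have "\<dots> = \<gamma> * \<bar>a * (x - q1) + c * (y - q2)\<bar>"
        using \<open>\<gamma> \<ge> 1\<close> by (simp add: abs_mult)
      finally have "- (\<gamma> * (a * (x - q1) + c * (y - q2))) \<le> \<gamma> * \<bar>a * (x - q1) + c * (y - q2)\<bar>" .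
      moreover have "\<gamma> * (4 * \<gamma> * Q x y) = 4 * \<gamma>\<^sup>2 * Q x y"
        by (simp add: power2_eq_square)
      ultimately show ?thesis
        using \<open>\<gamma> * D \<le> \<gamma> * (4 * \<gamma> * Q x y)\<close>
          \<open>\<gamma> * D \<ge> 4 * \<gamma> + 2 * \<gamma> * \<bar>a * (x - q1) + c * (y - q2)\<bar> + s\<close> by linarith
    qed
    then have "m * g x y * (4 * \<gamma>\<^sup>2 * Q x y - 4 * \<gamma> + 2 * \<gamma> * (a * (x - q1) + c * (y - q2)) - s) \<ge> 0"
      using \<open>m > 0\<close> by (simp add: gQ)
    moreover have "s * v x y < 0"
      using neg \<open>s > 0\<close> by (simp add: mult_pos_neg)
    moreover have "m * s * E \<ge> 0"
      using \<open>m > 0\<close> \<open>s > 0\<close> by (simp add: E_def)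
    moreover have "- fxx x y - fyy x y + a * fx x y + c * fy x y + s * f x y
      = - (fxx x y - m * ((4 * \<gamma>\<^sup>2 * (x - q1)\<^sup>2 - 2 * \<gamma>) * g x y - 0))
        - (fyy x y - m * ((4 * \<gamma>\<^sup>2 * (y - q2)\<^sup>2 - 2 * \<gamma>) * g x y - 0))
        + a * (fx x y - m * (- 2 * \<gamma> * (x - q1) * g x y - 0))
        + c * (fy x y - m * (- 2 * \<gamma> * (y - q2) * g x y - 0))
        + s * v x y - m * s * E
        - m * g x y * (4 * \<gamma>\<^sup>2 * Q x y - 4 * \<gamma> + 2 * \<gamma> * (a * (x - q1) + c * (y - q2)) - s)"
      by (simp add: v_def Q_def algebra_simps)
    ultimately show False
      using sup[of x y] d' by linarith
  qed
  then have "v p1 p2 \<ge> 0"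
    using z[of "(p1, p2)"] zxy K_iff pR by auto
  moreover have "g p1 p2 > E"
    using pR \<open>\<gamma> \<ge> 1\<close> by (simp add: gQ E_def)
  ultimately show ?thesis
    using \<open>m > 0\<close> by (simp add: v_def) (smt (verit) mult_pos_pos)
qed

section \<open>The principal eigenvalue\<close>

text \<open>Sliding argument: \<open>t\<close> is the largest multiple for which
  \<open>u - t * v\<close> stays nonnegative. This difference has minimum zero, and at the point of
  contact the two equations compare the eigenvalues. Exchanging the roles gives uniqueness.\<close>

lemma is_principal_eig_le:
  assumes "L1 > 0" "L2 > 0" and "is_principal_eig L1 L2 lam \<theta> b \<mu>" and "is_principal_eig L1 L2 lam \<theta> b \<nu>"
  shows "\<mu> \<le> \<nu>"
proof -
  obtain u v where u: "C2_plane u" "periodic2 L1 L2 u" "\<And>x y. u x y > 0"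
      "\<And>x y. - pdx (pdx u) x y - pdy (pdy u) x y + 2 * lam * cos \<theta> * pdx u x y
               + 2 * lam * sin \<theta> * pdy u x y - b x y * u x y = \<mu> * u x y"
    and v: "C2_plane v" "periodic2 L1 L2 v" "\<And>x y. v x y > 0"
      "\<And>x y. - pdx (pdx v) x y - pdy (pdy v) x y + 2 * lam * cos \<theta> * pdx v x y
               + 2 * lam * sin \<theta> * pdy v x y - b x y * v x y = \<nu> * v x y"
    using assms(3,4) unfolding is_principal_eig_def by blast
  have cont: "cont2 u" "cont2 v"
    using u v by (auto simp: C2_plane_def C1_plane_def)
  then have "cont2 (\<lambda>x y. u x y / v x y)"
    using v(3) unfolding cont2_def by (intro continuous_intros) (auto simp: less_imp_neq[symmetric])
  moreover have "periodic2 L1 L2 (\<lambda>x y. u x y / v x y)"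
    using u v by (simp add: periodic2_def)
  ultimately obtain x0 y0 where min: "\<And>x y. u x0 y0 / v x0 y0 \<le> u x y / v x y"
    using periodic2_attains_min[OF assms(1,2)] by blast
  define t where "t = u x0 y0 / v x0 y0"
  have "t > 0" using u v by (simp add: t_def)
  have uv: "u x0 y0 = t * v x0 y0"
    using v(3)[of x0 y0] by (simp add: t_def)
  have ge: "u x0 y0 - t * v x0 y0 \<le> u x y - t * v x y" for x y
    using min[of x y, folded t_def] v(3)[of x y] by (simp add: uv pos_le_divide_eq)
  note d = jet2_local_min[OF jet2_diff[OF C2_plane_jet2[OF u(1)] jet2_cmult[OF C2_plane_jet2[OF v(1)], of t]]
      zero_less_one, of x0 y0, OF ge]
  have "\<mu> * u x0 y0 = t * (\<nu> * v x0 y0) -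
      (pdx (pdx u) x0 y0 - t * pdx (pdx v) x0 y0) - (pdy (pdy u) x0 y0 - t * pdy (pdy v) x0 y0)
      + 2 * lam * cos \<theta> * (pdx u x0 y0 - t * pdx v x0 y0) + 2 * lam * sin \<theta> * (pdy u x0 y0 - t * pdy v x0 y0)
      - b x0 y0 * (u x0 y0 - t * v x0 y0)"
    unfolding u(4)[symmetric] v(4)[symmetric] by (simp add: algebra_simps)
  also have "\<dots> \<le> t * (\<nu> * v x0 y0)"
    using d uv by simp
  finally show ?thesis
    using \<open>t > 0\<close> v(3)[of x0 y0] by (simp add: uv)
qed

lemma princ_eig_eqI:
  assumes "L1 > 0" "L2 > 0" and "is_principal_eig L1 L2 lam \<theta> b \<mu>"
  shows "princ_eig L1 L2 lam \<theta> b = \<mu>"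
  unfolding princ_eig_def
  by (rule the_equality) (use assms is_principal_eig_le in \<open>auto intro: antisym\<close>)

text \<open>At a minimum of the positive eigenfunction the gradient vanishes, and both the negative
  Laplacian and \<open>- b * u\<close> are nonpositive.\<close>

lemma is_principal_eig_nonpos:
  assumes "L1 > 0" "L2 > 0" "\<And>x y. b x y \<ge> 0" and "is_principal_eig L1 L2 lam \<theta> b \<mu>"
  shows "\<mu> \<le> 0"
proof -
  obtain u where u: "C2_plane u" "periodic2 L1 L2 u" "\<And>x y. u x y > 0"
      "\<And>x y. - pdx (pdx u) x y - pdy (pdy u) x y + 2 * lam * cos \<theta> * pdx u x y
               + 2 * lam * sin \<theta> * pdy u x y - b x y * u x y = \<mu> * u x y"
    using assms(4) unfolding is_principal_eig_def by blast
  have "cont2 u"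
    using u by (simp add: C2_plane_def C1_plane_def)
  then obtain x0 y0 where min: "\<And>x y. u x0 y0 \<le> u x y"
    using u(2) periodic2_attains_min[OF assms(1,2)] by blast
  note d = jet2_local_min[OF C2_plane_jet2[OF u(1)] zero_less_one, of x0 y0, OF min]
  have "\<mu> * u x0 y0 \<le> 0"
    using u(4)[of x0 y0] d mult_nonneg_nonneg[OF assms(3) less_imp_le[OF u(3)], of x0 y0 x0 y0] by simp
  then show ?thesis
    using u(3)[of x0 y0] by (simp add: mult_le_0_iff)
qed

section \<open>Fourier series on the torus\<close>

lemma summable_on_UNIV_int:
  fixes f :: "int \<Rightarrow> real"
  assumes "\<And>n. f n \<ge> 0" "summable (\<lambda>n. f (int n))" "summable (\<lambda>n. f (- int n))"
  shows "f summable_on UNIV"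
proof -
  have "f summable_on range int"
    using assms by (subst summable_on_reindex) (auto simp: o_def summable_on_UNIV_nonneg_real_iff)
  moreover have "f summable_on range (\<lambda>n. - int n)"
    using assms by (subst summable_on_reindex) (auto simp: o_def summable_on_UNIV_nonneg_real_iff inj_on_def)
  ultimately have "f summable_on (range int \<union> range (\<lambda>n. - int n))"
    by (rule summable_on_union)
  moreover have "k \<in> range int \<union> range (\<lambda>n. - int n)" for k
    by (cases k rule: int_cases2) auto
  then have "range int \<union> range (\<lambda>n. - int n) = UNIV" by blast
  ultimately show ?thesis by simp
qed

lemma summable_inverse_quadratic:
  fixes a :: real
  assumes "a \<noteq> 0"
  shows "(\<lambda>k::int. 1 / (1 + (a * of_int k)\<^sup>2)) summable_on UNIV"
proof -
  have "summable (\<lambda>n. 1 / (1 + (a * real n)\<^sup>2))"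
  proof (rule summable_comparison_test_ev)
    show "\<forall>\<^sub>F n in sequentially. norm (1 / (1 + (a * real n)\<^sup>2)) \<le> (1 / a\<^sup>2) * inverse (real n ^ 2)"
      using eventually_gt_at_top[of 0]
    proof eventually_elim
      case (elim n)
      have "(a * real n)\<^sup>2 > 0" using elim assms by simp
      then have "1 / (1 + (a * real n)\<^sup>2) \<le> 1 / (a * real n)\<^sup>2"
        by (intro divide_left_mono) (auto intro!: mult_pos_pos add_pos_pos)
      then show ?case by (simp add: power_mult_distrib field_simps)
    qed
    show "summable (\<lambda>n. (1 / a\<^sup>2) * inverse (real n ^ 2))"
      by (intro summable_mult inverse_power_summable) simp
  qed
  then show ?thesis
    by (intro summable_on_UNIV_int) (auto simp: power_mult_distrib)
qed

text \<open>Enumerating the lattice brings in theorems about sequences: uniform convergence of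
  partial sums, termwise differentiation, Tannery's theorem. Absolute summability makes the order
  immaterial.\<close>

definition idx :: "nat \<Rightarrow> int \<times> int" where
  "idx = from_nat_into UNIV"

lemma bij_idx: "bij idx"
  unfolding idx_def
  by (rule bij_betw_from_nat_into) (simp_all add: finite_prod infinite_UNIV_int)

lemma abs_summable_enumerate:
  fixes f :: "int \<times> int \<Rightarrow> 'a :: banach"
  assumes "(\<lambda>k. norm (f k)) summable_on UNIV"
  shows "summable (\<lambda>n. norm (f (idx n)))" and "(\<lambda>n. f (idx n)) sums (infsum f UNIV)"
proof -
  have "(\<lambda>n. norm (f (idx n))) summable_on UNIV"
    using assms summable_on_reindex_bij_betw[OF bij_idx, of "\<lambda>k. norm (f k)"] by simp
  then show "summable (\<lambda>n. norm (f (idx n)))"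
    by (rule summable_on_imp_summable)
  have "(f has_sum infsum f UNIV) UNIV"
    using abs_summable_summable[OF assms] by simp
  then have "((\<lambda>n. f (idx n)) has_sum infsum f UNIV) UNIV"
    using has_sum_reindex_bij_betw[OF bij_idx] by blast
  then show "(\<lambda>n. f (idx n)) sums (infsum f UNIV)"
    by (rule has_sum_imp_sums)
qed

locale torus =
  fixes L1 L2 :: real
  assumes L1: "L1 > 0" and L2: "L2 > 0"
begin

definition kx :: "int \<times> int \<Rightarrow> real" where "kx k = 2 * pi / L1 * of_int (fst k)"
definition ky :: "int \<times> int \<Rightarrow> real" where "ky k = 2 * pi / L2 * of_int (snd k)"

definition ch :: "int \<times> int \<Rightarrow> real \<Rightarrow> real \<Rightarrow> complex" where
  "ch k x y = cis (kx k * x + ky k * y)"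

definition W :: "int \<times> int \<Rightarrow> real" where "W k = 1 + (kx k)\<^sup>2 + (ky k)\<^sup>2"

text \<open>The weight \<open>W\<close> is the symbol of 1 minus the Laplacian. Exponent 2 gives
  absolute convergence in two dimensions, exponent 3 a twice continuously differentiable sum, and
  the resolvent raises the exponent by one.\<close>

definition decay :: "nat \<Rightarrow> real \<Rightarrow> (int \<times> int \<Rightarrow> complex) \<Rightarrow> bool" where
  "decay p D c \<longleftrightarrow> (\<forall>k. norm (c k) \<le> D / W k ^ p)"

text \<open>Makes the series real-valued. It enters through \<open>coefficient_le_mean\<close>,
  where the modulus of \<open>ev c\<close> has to equal \<open>R c\<close>, and through the
  normalisation \<open>c 0 = 1\<close>, which presupposes a real mean.\<close>

definition herm :: "(int \<times> int \<Rightarrow> complex) \<Rightarrow> bool" where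
  "herm c \<longleftrightarrow> (\<forall>k. c (- k) = cnj (c k))"

definition ev :: "(int \<times> int \<Rightarrow> complex) \<Rightarrow> real \<Rightarrow> real \<Rightarrow> complex" where
  "ev c x y = (\<Sum>\<^sub>\<infinity>k. c k * ch k x y)"

definition R :: "(int \<times> int \<Rightarrow> complex) \<Rightarrow> real \<Rightarrow> real \<Rightarrow> real" where
  "R c x y = Re (ev c x y)"

definition X :: "(int \<times> int \<Rightarrow> complex) \<Rightarrow> int \<times> int \<Rightarrow> complex" where
  "X c k = \<i> * of_real (kx k) * c k"

definition Y :: "(int \<times> int \<Rightarrow> complex) \<Rightarrow> int \<times> int \<Rightarrow> complex" where
  "Y c k = \<i> * of_real (ky k) * c k"

lemma kx_simps [simp]: "kx 0 = 0" "kx (- k) = - kx k" "kx (j + k) = kx j + kx k"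
  by (simp_all add: kx_def distrib_left add_divide_distrib)

lemma ky_simps [simp]: "ky 0 = 0" "ky (- k) = - ky k" "ky (j + k) = ky j + ky k"
  by (simp_all add: ky_def distrib_left add_divide_distrib)

lemma norm_ch [simp]: "norm (ch k x y) = 1"
  by (simp add: ch_def)

lemma ch_add: "ch (j + k) x y = ch j x y * ch k x y"
  by (simp add: ch_def cis_mult algebra_simps)

lemma ch_minus: "ch (- k) x y = cnj (ch k x y)"
  by (simp add: ch_def cis_cnj algebra_simps)

lemma ch_0 [simp]: "ch 0 x y = 1"
  by (simp add: ch_def)

lemma W_ge_1: "W k \<ge> 1"
  by (simp add: W_def)

lemma W_pos [simp]: "W k > 0"
  using W_ge_1[of k] by linarith

lemma W_nonzero [simp]: "W k \<noteq> 0"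
  using W_pos[of k] by (metis less_irrefl)

lemma decay_nonneg:
  assumes "decay p D c"
  shows "D \<ge> 0"
proof -
  have "norm (c 0) \<le> D / W 0 ^ p" using assms unfolding decay_def by blast
  moreover have "W 0 = 1" by (simp add: W_def)
  ultimately have "norm (c 0) \<le> D" by simp
  then show ?thesis by (rule order_trans[OF norm_ge_zero])
qed

lemma decay_weaken:
  assumes "decay p D c" and "q \<le> p"
  shows "decay q D c"
  unfolding decay_def
proof
  fix k
  have "D / W k ^ p \<le> D / W k ^ q"
    using decay_nonneg[OF assms(1)] W_ge_1[of k] assms(2)
    by (intro divide_left_mono power_increasing) (auto intro!: mult_pos_pos)
  then show "norm (c k) \<le> D / W k ^ q"
    using assms(1) unfolding decay_def by (meson order_trans)
qed

text \<open>The square of \<open>W\<close> dominates the product of two one-dimensional weights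
  \<open>1 + (kx k)\<^sup>2\<close> and \<open>1 + (ky k)\<^sup>2\<close>, so the double series
  factors.\<close>

lemma summable_W: "(\<lambda>k. 1 / W k ^ 2) summable_on UNIV"
proof -
  let ?F = "\<lambda>m::int. 1 / (1 + (2 * pi / L1 * of_int m)\<^sup>2)"
  let ?G = "\<lambda>m::int. 1 / (1 + (2 * pi / L2 * of_int m)\<^sup>2)"
  have F: "?F summable_on UNIV" and G: "?G summable_on UNIV"
    using L1 L2 by (intro summable_inverse_quadratic; simp)+
  have "(\<lambda>(m, n). ?F m * ?G n) summable_on (UNIV \<times> UNIV)"
  proof (rule summable_on_SigmaI)
    show "((\<lambda>n. case (m, n) of (m, n) \<Rightarrow> ?F m * ?G n) has_sum ?F m * infsum ?G UNIV) UNIV" for m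
      unfolding prod.case by (intro has_sum_cmult_right has_sum_infsum G)
    show "(\<lambda>m. ?F m * infsum ?G UNIV) summable_on UNIV"
      by (intro summable_on_cmult_left F)
  qed auto
  then have "(\<lambda>k. ?F (fst k) * ?G (snd k)) summable_on UNIV"
    by (simp add: case_prod_unfold)
  then show ?thesis
  proof (rule summable_on_comparison_test)
    fix k :: "int \<times> int"
    have "(1 + (kx k)\<^sup>2) * (1 + (ky k)\<^sup>2) \<le> W k * W k"
      by (intro mult_mono) (auto simp: W_def)
    then have "1 / (W k * W k) \<le> 1 / ((1 + (kx k)\<^sup>2) * (1 + (ky k)\<^sup>2))"
      by (intro divide_left_mono) (auto intro!: mult_pos_pos add_pos_nonneg)
    then show "1 / W k ^ 2 \<le> ?F (fst k) * ?G (snd k)"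
      by (simp add: power2_eq_square kx_def ky_def)
  qed auto
qed

lemma decay_summable:
  assumes "decay 2 D c"
  shows "(\<lambda>k. norm (c k)) summable_on UNIV"
proof (rule summable_on_comparison_test)
  show "(\<lambda>k. D * (1 / W k ^ 2)) summable_on UNIV"
    by (intro summable_on_cmult_right summable_W)
qed (use assms in \<open>auto simp: decay_def\<close>)

lemma abs_summable_ch:
  assumes "(\<lambda>k. norm (c k)) summable_on UNIV"
  shows "(\<lambda>k. norm (c k * ch k x y)) summable_on UNIV"
  using assms by (simp add: norm_mult)

lemma has_sum_ev:
  assumes "(\<lambda>k. norm (c k)) summable_on UNIV"
  shows "((\<lambda>k. c k * ch k x y) has_sum ev c x y) UNIV"
  unfolding ev_def using abs_summable_summable[OF abs_summable_ch[OF assms]] by simp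

lemma has_sum_R:
  assumes "(\<lambda>k. norm (c k)) summable_on UNIV"
  shows "((\<lambda>k. Re (c k * ch k x y)) has_sum R c x y) UNIV"
  unfolding R_def by (rule has_sum_Re[OF has_sum_ev[OF assms]])

lemma norm_ev_le:
  assumes "(\<lambda>k. norm (c k)) summable_on UNIV"
  shows "norm (ev c x y) \<le> (\<Sum>\<^sub>\<infinity>k. norm (c k))"
  by (rule norm_infsum_le[OF has_sum_ev[OF assms] has_sum_infsum[OF assms]]) (simp add: norm_mult)

lemma uniform_limit_ev:
  assumes "(\<lambda>k. norm (c k)) summable_on UNIV"
  shows "uniform_limit A (\<lambda>N p. \<Sum>n<N. c (idx n) * ch (idx n) (fst p) (snd p))
    (\<lambda>p. ev c (fst p) (snd p)) sequentially"
proof -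
  have "uniform_limit A (\<lambda>N p. \<Sum>n<N. c (idx n) * ch (idx n) (fst p) (snd p))
    (\<lambda>p. \<Sum>n. c (idx n) * ch (idx n) (fst p) (snd p)) sequentially"
    by (rule Weierstrass_m_test[OF _ abs_summable_enumerate(1)[OF assms]]) (simp add: norm_mult)
  moreover have "(\<Sum>n. c (idx n) * ch (idx n) x y) = ev c x y" for x y
    using abs_summable_enumerate(2)[OF abs_summable_ch[OF assms]] by (simp add: sums_iff ev_def)
  ultimately show ?thesis by simp
qed

lemma continuous_on_ch: "continuous_on A (\<lambda>p. ch k (fst p) (snd p))"
  unfolding ch_def by (intro continuous_intros)

lemma continuous_on_ev:
  assumes "(\<lambda>k. norm (c k)) summable_on UNIV"
  shows "continuous_on A (\<lambda>p. ev c (fst p) (snd p))"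
  by (rule uniform_limit_theorem[OF _ uniform_limit_ev[OF assms]])
    (auto intro!: always_eventually continuous_intros continuous_on_ch)

lemma cont2_R:
  assumes "(\<lambda>k. norm (c k)) summable_on UNIV"
  shows "cont2 (R c)"
  unfolding cont2_def R_def by (intro continuous_intros continuous_on_ev assms)

lemma ch_DERIV:
  "((\<lambda>s. Re (z * ch k s y)) has_real_derivative Re (\<i> * of_real (kx k) * z * ch k x y)) (at x)"
  "((\<lambda>t. Re (z * ch k x t)) has_real_derivative Re (\<i> * of_real (ky k) * z * ch k x y)) (at y)"
  unfolding ch_def cis.ctr
  by (auto intro!: derivative_eq_intros simp: algebra_simps)

lemma R_series_DERIV:
  fixes f f' :: "int \<times> int \<Rightarrow> real \<Rightarrow> real"
  assumes d: "\<And>k s. (f k has_real_derivative f' k s) (at s)"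
    and f: "\<And>k s. \<bar>f k s\<bar> \<le> m k" "m summable_on UNIV"
    and f': "\<And>k s. \<bar>f' k s\<bar> \<le> m' k" "m' summable_on UNIV"
  shows "((\<lambda>s. infsum (\<lambda>k. f k s) UNIV) has_real_derivative infsum (\<lambda>k. f' k s) UNIV) (at s)"
proof -
  have m: "(\<lambda>k. norm (m k)) summable_on UNIV" "(\<lambda>k. norm (m' k)) summable_on UNIV"
    using f(2) f'(2) summable_on_iff_abs_summable_on_real by blast+
  have a: "(\<lambda>k. norm (f k s)) summable_on UNIV" for s
    using f(2) by (rule Infinite_Sum.abs_summable_on_comparison_test') (simp add: f(1))
  have a': "(\<lambda>k. norm (f' k s)) summable_on UNIV" for s
    using f'(2) by (rule Infinite_Sum.abs_summable_on_comparison_test') (simp add: f'(1))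
  note e = a[THEN abs_summable_enumerate(2)] a'[THEN abs_summable_enumerate(2)]
  have "m (idx n) \<ge> 0" "m' (idx n) \<ge> 0" for n
    using f(1)[of "idx n" 0] f'(1)[of "idx n" 0] by linarith+
  then have s: "summable (\<lambda>n. m (idx n))" "summable (\<lambda>n. m' (idx n))"
    using m[THEN abs_summable_enumerate(1)] by simp_all
  have "((\<lambda>s. \<Sum>n. f (idx n) s) has_field_derivative (\<Sum>n. f' (idx n) s)) (at s)"
  proof (rule has_field_derivative_series'(2))
    show "uniformly_convergent_on UNIV (\<lambda>n s. \<Sum>i<n. f' (idx i) s)"
      using f'(1) by (intro Weierstrass_m_test'[OF _ s(2)]) simp
    show "summable (\<lambda>n. f (idx n) 0)"
      using e(1) by (simp add: sums_iff)
  qed (use d in auto)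
  then show ?thesis
    using e by (simp add: sums_iff)
qed

lemma R_DERIV:
  assumes c: "(\<lambda>k. norm (c k)) summable_on UNIV"
  shows "(\<lambda>k. norm (X c k)) summable_on UNIV \<Longrightarrow> ((\<lambda>s. R c s y) has_real_derivative R (X c) x y) (at x)"
    and "(\<lambda>k. norm (Y c k)) summable_on UNIV \<Longrightarrow> ((\<lambda>t. R c x t) has_real_derivative R (Y c) x y) (at y)"
proof -
  have bound: "\<bar>Re (z * ch k x y)\<bar> \<le> norm z" for z k x y
    using abs_Re_le_cmod[of "z * ch k x y"] by (simp add: norm_mult)
  have R: "R c x y = infsum (\<lambda>k. Re (c k * ch k x y)) UNIV"
    if "(\<lambda>k. norm (c k)) summable_on UNIV" for c x y
    by (rule infsumI[OF has_sum_R[OF that], symmetric])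
  show "((\<lambda>s. R c s y) has_real_derivative R (X c) x y) (at x)" if "(\<lambda>k. norm (X c k)) summable_on UNIV"
    unfolding R[OF c] R[OF that]
    by (rule R_series_DERIV[OF _ bound c bound that]) (unfold X_def, rule ch_DERIV)
  show "((\<lambda>t. R c x t) has_real_derivative R (Y c) x y) (at y)" if "(\<lambda>k. norm (Y c k)) summable_on UNIV"
    unfolding R[OF c] R[OF that]
    by (rule R_series_DERIV[OF _ bound c bound that]) (unfold Y_def, rule ch_DERIV)
qed

lemma decay_multiplier:
  assumes "decay (Suc p) D c" and "\<And>k. norm (d k) \<le> W k * norm (c k)"
  shows "decay p D d"
  unfolding decay_def
proof
  fix k
  have "norm (d k) \<le> W k * (D / W k ^ Suc p)"
    using assms W_pos[of k] unfolding decay_def by (meson mult_left_mono order_trans less_imp_le)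
  also have "\<dots> = D / W k ^ p"
    using W_pos[of k] by (simp add: field_simps)
  finally show "norm (d k) \<le> D / W k ^ p" .
qed

lemma frequency_le_W: "\<bar>kx k\<bar> \<le> W k" "\<bar>ky k\<bar> \<le> W k" "\<bar>kx k\<bar> * \<bar>kx k\<bar> \<le> W k" "\<bar>ky k\<bar> * \<bar>ky k\<bar> \<le> W k"
  "\<bar>kx k\<bar> * \<bar>ky k\<bar> \<le> W k" "\<bar>ky k\<bar> * \<bar>kx k\<bar> \<le> W k" "kx k * kx k \<le> W k" "ky k * ky k \<le> W k"
proof -
  have *: "2 * t \<le> 1 + t * t" "2 * (t * u) \<le> t * t + u * u" for t u :: real
    using zero_le_square[of "1 - t"] zero_le_square[of "t - u"] by (auto simp: algebra_simps)
  show "\<bar>kx k\<bar> \<le> W k" "\<bar>ky k\<bar> \<le> W k"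
    using *(1)[of "\<bar>kx k\<bar>"] *(1)[of "\<bar>ky k\<bar>"] zero_le_square[of "kx k"] zero_le_square[of "ky k"]
    unfolding W_def power2_eq_square abs_mult_self_eq by linarith+
  show "\<bar>kx k\<bar> * \<bar>ky k\<bar> \<le> W k" "\<bar>ky k\<bar> * \<bar>kx k\<bar> \<le> W k"
    using *(2)[of "\<bar>kx k\<bar>" "\<bar>ky k\<bar>"] zero_le_square[of "kx k"] zero_le_square[of "ky k"]
    unfolding W_def power2_eq_square abs_mult_self_eq mult.commute[of "\<bar>ky k\<bar>"] by linarith+
  show "\<bar>kx k\<bar> * \<bar>kx k\<bar> \<le> W k" "\<bar>ky k\<bar> * \<bar>ky k\<bar> \<le> W k" "kx k * kx k \<le> W k" "ky k * ky k \<le> W k"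
    by (auto simp: W_def power2_eq_square)
qed

text \<open>Frequency monomials of degree one or two are bounded by \<open>W\<close>, so even two
  derivatives cost a single power.\<close>

lemma decay_derivatives:
  assumes "decay (Suc p) D c"
  shows "decay p D (X c)" "decay p D (Y c)" "decay p D (X (X c))" "decay p D (X (Y c))"
    "decay p D (Y (X c))" "decay p D (Y (Y c))"
proof -
  have n: "norm (X c k) = \<bar>kx k\<bar> * norm (c k)" "norm (Y c k) = \<bar>ky k\<bar> * norm (c k)" for c k
    by (simp_all add: X_def Y_def norm_mult)
  show "decay p D (X c)" "decay p D (Y c)" "decay p D (X (X c))" "decay p D (X (Y c))"
    "decay p D (Y (X c))" "decay p D (Y (Y c))"
    by (rule decay_multiplier[OF assms], unfold n mult.assoc[symmetric],
        intro mult_right_mono frequency_le_W norm_ge_zero)+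
qed

lemma R_C1_plane:
  assumes "decay 2 D c" "decay 2 D (X c)" "decay 2 D (Y c)"
  shows "C1_plane (R c)" "pdx (R c) = R (X c)" "pdy (R c) = R (Y c)"
proof -
  note s = assms[THEN decay_summable]
  note d = R_DERIV[OF s(1)]
  show pd: "pdx (R c) = R (X c)" "pdy (R c) = R (Y c)"
    using d s by (auto simp: pdx_def pdy_def fun_eq_iff intro!: DERIV_imp_deriv)
  show "C1_plane (R c)"
    unfolding C1_plane_def pd real_differentiable_def
    using d(1)[OF s(2)] d(2)[OF s(3)] s[THEN cont2_R] by blast
qed

lemma R_C2_plane:
  assumes "decay 3 D c"
  shows "C2_plane (R c)"
    and "pdx (R c) = R (X c)" "pdy (R c) = R (Y c)"
    and "pdx (pdx (R c)) = R (X (X c))" "pdy (pdy (R c)) = R (Y (Y c))"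
proof -
  have "decay (Suc 2) D c" using assms by (simp add: numeral_eq_Suc)
  note d = decay_derivatives[OF this] decay_weaken[OF assms, of 2, simplified]
  note C = R_C1_plane[OF d(7,1,2)] and CX = R_C1_plane[OF d(1,3,5)] and CY = R_C1_plane[OF d(2,4,6)]
  show "C2_plane (R c)" "pdx (R c) = R (X c)" "pdy (R c) = R (Y c)"
    "pdx (pdx (R c)) = R (X (X c))" "pdy (pdy (R c)) = R (Y (Y c))"
    unfolding C2_plane_def using C CX CY by auto
qed

lemma periodic2_R: "periodic2 L1 L2 (R c)"
proof -
  have "cis (t + 2 * pi * of_int m) = cis t" for t and m :: int
    using cis_mult[of t "2 * pi * of_int m"] cis_multiple_2pi[of "of_int m"] by simp
  moreover have "kx k * (x + L1) + ky k * y = kx k * x + ky k * y + 2 * pi * of_int (fst k)"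
    "kx k * x + ky k * (y + L2) = kx k * x + ky k * y + 2 * pi * of_int (snd k)" for k x y
    using L1 L2 by (simp_all add: kx_def ky_def distrib_left)
  ultimately have "ch k (x + L1) y = ch k x y" "ch k x (y + L2) = ch k x y" for k x y
    unfolding ch_def by metis+
  then show ?thesis
    by (simp add: periodic2_def R_def ev_def)
qed

text \<open>Dominated convergence: the common bound \<open>D / W k ^ 2\<close> is a summable
  majorant, so convergence of each coefficient is enough.\<close>

lemma tendsto_ev:
  assumes "\<And>n. decay 2 D (c n)" and "\<And>k. (\<lambda>n. c n k) \<longlonglongrightarrow> c' k"
  shows "decay 2 D c'" and "(\<lambda>n. ev (c n) x y) \<longlonglongrightarrow> ev c' x y"
proof -
  show d: "decay 2 D c'"
    unfolding decay_def
  proof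
    fix k show "norm (c' k) \<le> D / W k ^ 2"
      by (rule LIMSEQ_le_const2[OF tendsto_norm[OF assms(2)]]) (use assms(1) in \<open>unfold decay_def, blast\<close>)
  qed
  have e: "ev c x y = (\<Sum>n. c (idx n) * ch (idx n) x y)" if "decay 2 D c" for c
    using abs_summable_enumerate(2)[OF abs_summable_ch[OF decay_summable[OF that]]]
    by (simp add: sums_iff ev_def)
  have "(\<lambda>k. norm (D / W k ^ 2)) summable_on UNIV"
    using summable_on_cmult_right[OF summable_W, of D] decay_nonneg[OF d] by (simp add: abs_mult)
  from abs_summable_enumerate(1)[OF this]
  have "summable (\<lambda>n. D / W (idx n) ^ 2)"
    using decay_nonneg[OF d] by simp
  moreover have "\<forall>\<^sub>F (i, n) in at_top \<times>\<^sub>F sequentially. norm (c n (idx i) * ch (idx i) x y) \<le> D / W (idx i) ^ 2"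
  proof -
    have "norm (c n (idx i) * ch (idx i) x y) \<le> D / W (idx i) ^ 2" for n i
      using assms(1)[of n] unfolding decay_def by (simp only: norm_mult norm_ch mult_1_right)
    then show ?thesis by (intro always_eventually) (simp add: split_beta)
  qed
  moreover have "(\<lambda>n. c n (idx i) * ch (idx i) x y) \<longlonglongrightarrow> c' (idx i) * ch (idx i) x y" for i
    by (intro tendsto_intros assms(2))
  ultimately have "(\<lambda>n. \<Sum>i. c n (idx i) * ch (idx i) x y) \<longlonglongrightarrow> (\<Sum>i. c' (idx i) * ch (idx i) x y)"
    using tannerys_theorem[of "\<lambda>i n. c n (idx i) * ch (idx i) x y"] by (simp add: split_beta)
  then show "(\<lambda>n. ev (c n) x y) \<longlonglongrightarrow> ev c' x y"
    using e[OF assms(1)] e[OF d] by simp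
qed

lemma ev_shift: "ev c x y * ch j x y = ev (\<lambda>k. c (k - j)) x y"
proof -
  have "ev (\<lambda>k. c (k - j)) x y = (\<Sum>\<^sub>\<infinity>k. c k * ch (k + j) x y)"
    unfolding ev_def by (rule infsum_reindex_bij_witness[of _ "\<lambda>k. k + j" "\<lambda>k. k - j"]) auto
  also have "\<dots> = (\<Sum>\<^sub>\<infinity>k. c k * ch k x y * ch j x y)"
    by (simp add: ch_add mult.assoc)
  also have "\<dots> = ev c x y * ch j x y"
    unfolding ev_def by (rule infsum_cmult_left')
  finally show ?thesis by simp
qed

lemma ev_herm:
  assumes "herm c"
  shows "ev c x y = of_real (R c x y)"
proof -
  have "cnj (ev c x y) = (\<Sum>\<^sub>\<infinity>k. cnj (c k * ch k x y))"
    unfolding ev_def by (rule infsum_cnj[symmetric])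
  also have "\<dots> = (\<Sum>\<^sub>\<infinity>k. c (- k) * ch (- k) x y)"
    using assms by (simp only: herm_def ch_minus complex_cnj_mult)
  also have "\<dots> = ev c x y"
    unfolding ev_def by (rule infsum_reindex_bij_witness[of _ uminus uminus]) auto
  finally show ?thesis
    unfolding R_def by (metis Reals_cnj_iff of_real_Re)
qed

lemma integral_cis_period:
  fixes m :: int
  assumes "L > 0"
  shows "integral {0..L} (\<lambda>t. cis (2 * pi / L * of_int m * t)) = (if m = 0 then of_real L else 0)"
proof (cases "m = 0")
  case False
  define w where "w = 2 * pi / L * of_int m"
  have "w \<noteq> 0" using False assms by (simp add: w_def)
  have "((\<lambda>t. cis (w * t)) has_integral (cis (w * L) / (\<i> * w) - cis (w * 0) / (\<i> * w))) {0..L}"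
  proof (rule fundamental_theorem_of_calculus)
    show "((\<lambda>t. cis (w * t) / (\<i> * w)) has_vector_derivative cis (w * t)) (at t within {0..L})" for t
      unfolding cis_conv_exp using \<open>w \<noteq> 0\<close>
      by (auto intro!: derivative_eq_intros has_vector_derivative_real_field simp: field_simps)
  qed (use assms in auto)
  moreover have "cis (w * L) = 1"
    using assms cis_multiple_2pi[of "of_int m"] by (simp add: w_def)
  ultimately show ?thesis
    using False by (simp add: w_def integral_unique)
qed (use assms in \<open>simp add: scaleR_conv_of_real\<close>)

lemma has_integral_ch:
  "((\<lambda>p. ch k (fst p) (snd p)) has_integral (if k = 0 then of_real (L1 * L2) else 0)) (cbox (0, 0) (L1, L2))"
proof -
  have "(\<lambda>p. ch k (fst p) (snd p)) integrable_on cbox (0, 0) (L1, L2)"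
    by (intro integrable_continuous continuous_on_ch)
  moreover have "integral (cbox (0, 0) (L1, L2)) (\<lambda>p. ch k (fst p) (snd p)) =
      integral {0..L1} (\<lambda>x. integral {0..L2} (\<lambda>y. ch k x y))"
    by (subst integral_prod_continuous) (auto intro: continuous_on_ch)
  moreover have "\<dots> = integral {0..L1} (\<lambda>x. cis (kx k * x)) * integral {0..L2} (\<lambda>y. cis (ky k * y))"
    by (simp add: ch_def cis_mult[symmetric])
  ultimately show ?thesis
    using integral_cis_period[OF L1, of "fst k"] integral_cis_period[OF L2, of "snd k"]
    by (auto simp: kx_def ky_def has_integral_integral prod_eq_iff split: if_splits)
qed

lemma has_integral_ev:
  assumes c: "(\<lambda>k. norm (c k)) summable_on UNIV"
  shows "((\<lambda>p. ev c (fst p) (snd p)) has_integral (of_real (L1 * L2) * c 0)) (cbox (0, 0) (L1, L2))"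
proof -
  define n0 where "n0 = inv idx 0"
  have n0: "idx n = 0 \<longleftrightarrow> n = n0" for n
    unfolding n0_def using bij_idx by (metis bij_inv_eq_iff)
  obtain I J where I: "\<And>N. ((\<lambda>p. \<Sum>n<N. c (idx n) * ch (idx n) (fst p) (snd p)) has_integral I N) (cbox (0, 0) (L1, L2))"
    and J: "((\<lambda>p. ev c (fst p) (snd p)) has_integral J) (cbox (0, 0) (L1, L2))" and lim: "I \<longlonglongrightarrow> J"
    by (rule uniform_limit_integral_cbox[OF uniform_limit_ev[OF c, of "cbox (0, 0) (L1, L2)"]])
      (auto intro!: continuous_intros continuous_on_ch)
  have "I N = (\<Sum>n<N. c (idx n) * (if idx n = 0 then of_real (L1 * L2) else 0))" for N
    by (rule has_integral_unique[OF I])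
      (intro has_integral_sum has_integral_mult_right has_integral_ch finite_lessThan)
  moreover have "idx n0 = 0" using n0 by blast
  ultimately have "I N = (if n0 < N then of_real (L1 * L2) * c 0 else 0)" for N
    by (simp add: n0 if_distrib[of "(*) _"] cong: if_cong)
  then have "\<forall>\<^sub>F N in sequentially. I N = of_real (L1 * L2) * c 0"
    using eventually_mono[OF eventually_gt_at_top[of n0]] by simp
  then have "I \<longlonglongrightarrow> of_real (L1 * L2) * c 0"
    by (rule tendsto_eventually)
  then show ?thesis
    using J lim LIMSEQ_unique by blast
qed

end

section \<open>Existence of the principal eigenfunction\<close>

declare split_paired_All [simp del]

lemma has_sum_neg:
  fixes f :: "'a \<Rightarrow> 'b :: topological_ab_group_add"
  shows "(f has_sum l) A \<Longrightarrow> ((\<lambda>x. - f x) has_sum - l) A"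
  by (simp add: has_sum_uminus)

context torus
begin

lemma mean_mono:
  assumes "(\<lambda>k. norm (c k)) summable_on UNIV" "(\<lambda>k. norm (c' k)) summable_on UNIV"
    and "\<And>x y. R c x y \<le> R c' x y"
  shows "Re (c 0) \<le> Re (c' 0)"
proof -
  have i: "((\<lambda>p. R c (fst p) (snd p)) has_integral (L1 * L2 * Re (c 0))) (cbox (0, 0) (L1, L2))"
    if "(\<lambda>k. norm (c k)) summable_on UNIV" for c
    using has_integral_linear[OF has_integral_ev[OF that] bounded_linear_Re]
    by (simp add: R_def o_def)
  have "L1 * L2 * Re (c 0) \<le> L1 * L2 * Re (c' 0)"
    by (rule has_integral_le[OF i i]) (use assms in auto)
  then show ?thesis
    using L1 L2 by simp
qed

text \<open>A coefficient averages \<open>R c\<close> against a function of modulus one, and a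
  nonnegative function is its own absolute value. This is the a priori bound behind compactness:
  fixing the mean bounds all coefficients.\<close>

lemma coefficient_le_mean:
  assumes c: "(\<lambda>k. norm (c k)) summable_on UNIV" and "herm c" and nonneg: "\<And>x y. R c x y \<ge> 0"
  shows "norm (c k) \<le> Re (c 0)"
proof -
  let ?B = "cbox (0, 0) (L1, L2)"
  have "(\<lambda>j. norm (c (j + k))) summable_on UNIV"
    using c by (subst summable_on_reindex_bij_witness[of _ "\<lambda>j. j - k" "\<lambda>j. j + k"]) auto
  from has_integral_ev[OF this]
  have i: "((\<lambda>p. ev c (fst p) (snd p) * ch (- k) (fst p) (snd p)) has_integral (of_real (L1 * L2) * c k)) ?B"
    by (simp add: ev_shift)
  have m: "((\<lambda>p. R c (fst p) (snd p)) has_integral (L1 * L2 * Re (c 0))) ?B"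
    using has_integral_linear[OF has_integral_ev[OF c] bounded_linear_Re]
    by (simp add: R_def o_def)
  have "norm (integral ?B (\<lambda>p. ev c (fst p) (snd p) * ch (- k) (fst p) (snd p)))
      \<le> integral ?B (\<lambda>p. R c (fst p) (snd p))"
    by (rule integral_norm_bound_integral)
      (use i m nonneg ev_herm[OF \<open>herm c\<close>] in \<open>auto simp: norm_mult\<close>)
  then have "norm (of_real (L1 * L2) * c k) \<le> L1 * L2 * Re (c 0)"
    by (simp only: integral_unique[OF i] integral_unique[OF m])
  then show ?thesis
    using L1 L2 by (simp add: norm_mult)
qed

lemma R_scale: "R (\<lambda>k. of_real t * c k) x y = t * R c x y"
  unfolding R_def ev_def by (simp add: mult.assoc infsum_cmult_right')

section \<open>Resolvent and multiplication operators on Fourier coefficients\<close>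

definition symb :: "real \<Rightarrow> real \<Rightarrow> real \<Rightarrow> int \<times> int \<Rightarrow> complex" where
  "symb a d s k = of_real (s + (kx k)\<^sup>2 + (ky k)\<^sup>2) + \<i> * of_real (a * kx k + d * ky k)"

text \<open>The resolvent \<open>(-\<Delta> + a \<partial>\<^sub>x + d \<partial>\<^sub>y + s)\<^sup>-\<^sup>1\<close> in Fourier coefficients.\<close>

definition G :: "real \<Rightarrow> real \<Rightarrow> real \<Rightarrow> (int \<times> int \<Rightarrow> complex) \<Rightarrow> int \<times> int \<Rightarrow> complex" where
  "G a d s c k = c k / symb a d s k"

text \<open>The drift contributes only to the imaginary part and cannot lower the modulus, so the
  gain of one power of \<open>W\<close> is uniform in the drift and in \<open>s\<close>.\<close>

lemma norm_symb_ge: "s \<ge> 1 \<Longrightarrow> W k \<le> norm (symb a d s k)"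
  using complex_Re_le_cmod[of "symb a d s k"] by (simp add: symb_def W_def)

lemma symb_nonzero: "s \<ge> 1 \<Longrightarrow> symb a d s k \<noteq> 0"
  using norm_symb_ge[of s k a d] W_ge_1[of k] by auto

lemma decay_G:
  assumes "s \<ge> 1" and "decay p D c"
  shows "decay (Suc p) D (G a d s c)"
  unfolding decay_def
proof
  fix k
  have "norm (c k) \<le> D / W k ^ p"
    using assms(2) unfolding decay_def by blast
  then have "norm (G a d s c k) \<le> (D / W k ^ p) / W k"
    unfolding G_def norm_divide
    using norm_symb_ge[OF assms(1)] by (intro frac_le) (auto simp: decay_nonneg[OF assms(2)] less_imp_le)
  then show "norm (G a d s c k) \<le> D / W k ^ Suc p"
    by (simp add: mult.commute)
qed

lemma symb_minus: "symb a d s (- k) = cnj (symb a d s k)"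
  by (simp add: symb_def complex_eq_iff)

lemma herm_G: "herm c \<Longrightarrow> herm (G a d s c)"
  unfolding herm_def by (simp add: G_def symb_minus)

lemma pde_G:
  fixes a d s :: real
  assumes s: "s \<ge> 1" and "decay 2 D c"
  defines "g \<equiv> G a d s c"
  shows "- R (X (X g)) x y - R (Y (Y g)) x y + a * R (X g) x y + d * R (Y g) x y + s * R g x y = R c x y"
proof -
  have g: "decay (Suc 2) D g"
    unfolding g_def by (rule decay_G) fact+
  note sm = decay_derivatives[OF g, THEN decay_summable]
    decay_weaken[OF g, of 2, simplified, THEN decay_summable]
  have "((\<lambda>k. - Re (X (X g) k * ch k x y) - Re (Y (Y g) k * ch k x y) + a * Re (X g k * ch k x y)
      + d * Re (Y g k * ch k x y) + s * Re (g k * ch k x y)) has_sum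
    (- R (X (X g)) x y - R (Y (Y g)) x y + a * R (X g) x y + d * R (Y g) x y + s * R g x y)) UNIV"
    unfolding diff_conv_add_uminus
    by (intro has_sum_add has_sum_cmult_right has_sum_neg has_sum_R sm)
  moreover have "- Re (X (X g) k * z) - Re (Y (Y g) k * z) + a * Re (X g k * z)
      + d * Re (Y g k * z) + s * Re (g k * z) = Re (c k * z)" for k z
  proof -
    have Re_scale: "Re (of_real r * w) = r * Re w" for r w by simp
    have "c k = symb a d s k * g k"
      using symb_nonzero[OF s] by (simp add: g_def G_def)
    then have "c k = - X (X g) k - Y (Y g) k + of_real a * X g k + of_real d * Y g k + of_real s * g k"
      by (simp add: X_def Y_def symb_def power2_eq_square algebra_simps)
    then have "c k * z = (- X (X g) k - Y (Y g) k + of_real a * X g k + of_real d * Y g k + of_real s * g k) * z"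
      by (rule arg_cong)
    then have "c k * z = - (X (X g) k * z) - Y (Y g) k * z + of_real a * (X g k * z)
        + of_real d * (Y g k * z) + of_real s * (g k * z)"
      by (simp add: algebra_simps)
    then show ?thesis
      by (simp only: plus_complex.sel minus_complex.sel uminus_complex.sel Re_scale)
  qed
  ultimately show ?thesis
    using has_sum_R[OF decay_summable[OF assms(2)], of x y] by (simp only: has_sum_unique)
qed

text \<open>What the eigenfunction argument asks of multiplication by \<open>b\<close>. The
  continuity clause concerns bare coefficientwise convergence without a common bound; it suits
  trigonometric polynomials, where each output coefficient involves finitely many input ones. All
  clauses survive composition, which handles products of functions.\<close>

definition multiplier :: "((int \<times> int \<Rightarrow> complex) \<Rightarrow> (int \<times> int \<Rightarrow> complex)) \<Rightarrow>
    (real \<Rightarrow> real \<Rightarrow> real) \<Rightarrow> bool" where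
  "multiplier M b \<longleftrightarrow>
    (\<forall>p. \<exists>C\<ge>0. \<forall>c D. decay p D c \<longrightarrow> decay p (C * D) (M c)) \<and>
    (\<forall>c. herm c \<longrightarrow> herm (M c)) \<and>
    (\<forall>c D x y. decay 2 D c \<longrightarrow> R (M c) x y = b x y * R c x y) \<and>
    (\<forall>c c'. (\<forall>k. (\<lambda>n. c n k) \<longlonglongrightarrow> c' k) \<longrightarrow> (\<forall>k. (\<lambda>n. M (c n) k) \<longlonglongrightarrow> M c' k)) \<and>
    (\<forall>t c. M (\<lambda>k. of_real t * c k) = (\<lambda>k. of_real t * M c k))"

lemma
  assumes "multiplier M b"
  shows multiplier_decay: "\<exists>C\<ge>0. \<forall>c D. decay p D c \<longrightarrow> decay p (C * D) (M c)"
    and multiplier_herm: "herm c \<Longrightarrow> herm (M c)"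
    and multiplier_R: "decay 2 D c \<Longrightarrow> R (M c) x y = b x y * R c x y"
    and multiplier_tendsto: "(\<And>k. (\<lambda>n. cs n k) \<longlonglongrightarrow> c k) \<Longrightarrow> (\<lambda>n. M (cs n) k) \<longlonglongrightarrow> M c k"
    and multiplier_scale: "M (\<lambda>k. of_real t * c k) = (\<lambda>k. of_real t * M c k)"
proof -
  note m = assms[unfolded multiplier_def]
  show "\<exists>C\<ge>0. \<forall>c D. decay p D c \<longrightarrow> decay p (C * D) (M c)"
    by (rule m[THEN conjunct1, rule_format])
  show "herm (M c)" if "herm c"
    using that by (rule m[THEN conjunct2, THEN conjunct1, rule_format])
  show "R (M c) x y = b x y * R c x y" if "decay 2 D c"
    using that by (rule m[THEN conjunct2, THEN conjunct2, THEN conjunct1, rule_format])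
  show "(\<lambda>n. M (cs n) k) \<longlonglongrightarrow> M c k" if "\<And>k. (\<lambda>n. cs n k) \<longlonglongrightarrow> c k"
    using that by (rule m[THEN conjunct2, THEN conjunct2, THEN conjunct2, THEN conjunct1, rule_format])
  show "M (\<lambda>k. of_real t * c k) = (\<lambda>k. of_real t * M c k)"
    by (rule m[THEN conjunct2, THEN conjunct2, THEN conjunct2, THEN conjunct2, rule_format])
qed

definition rapid :: "(int \<times> int \<Rightarrow> complex) \<Rightarrow> bool" where
  "rapid c \<longleftrightarrow> (\<exists>D. decay 3 D c)"

lemma rapid_summable: "rapid c \<Longrightarrow> (\<lambda>k. norm (c k)) summable_on UNIV"
  unfolding rapid_def using decay_weaken[of 3 _ c 2] decay_summable by auto

end

section \<open>Subsolutions and the extremal level\<close>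

locale torus_operator = torus +
  fixes a d :: real and M :: "(int \<times> int \<Rightarrow> complex) \<Rightarrow> (int \<times> int \<Rightarrow> complex)"
    and \<beta> :: "real \<Rightarrow> real \<Rightarrow> real" and B :: real
  assumes multiplier: "multiplier M \<beta>" and \<beta>_ge_1: "\<And>x y. \<beta> x y \<ge> 1" and \<beta>_le: "\<And>x y. \<beta> x y \<le> B"
begin

text \<open>With \<beta> standing for \<open>b + 1\<close>, a fixed point satisfies the eigenvalue
  equation for \<open>b\<close> with eigenvalue \<open>1 - s\<close>.\<close>

definition T :: "real \<Rightarrow> (int \<times> int \<Rightarrow> complex) \<Rightarrow> (int \<times> int \<Rightarrow> complex)" where
  "T s c = G a d s (M c)"

lemma R_M:
  assumes "rapid c"
  shows "R (M c) x y = \<beta> x y * R c x y"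
proof -
  obtain D where "decay 3 D c" using assms unfolding rapid_def by blast
  then have "decay 2 D c" by (rule decay_weaken) simp
  then show ?thesis by (rule multiplier_R[OF multiplier])
qed

lemma M_rapid:
  assumes "rapid c"
  shows "rapid (M c)"
proof -
  obtain D where "decay 3 D c" using assms unfolding rapid_def by blast
  moreover obtain C where "\<And>c D. decay 3 D c \<Longrightarrow> decay 3 (C * D) (M c)"
    using multiplier_decay[OF multiplier, of 3] by blast
  ultimately show ?thesis unfolding rapid_def by blast
qed

lemma T_herm: "herm c \<Longrightarrow> herm (T s c)"
  unfolding T_def by (intro herm_G multiplier_herm[OF multiplier])

lemma T_rapid:
  assumes "s \<ge> 1" "rapid c"
  shows "rapid (T s c)"
proof -
  obtain D where "decay 3 D (M c)" using M_rapid[OF assms(2)] unfolding rapid_def by blast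
  then have "decay 3 D (T s c)"
    unfolding T_def by (rule decay_weaken[OF decay_G[OF assms(1)]]) simp
  then show ?thesis unfolding rapid_def by blast
qed

lemma T_C2_plane:
  assumes "s \<ge> 1" "rapid c"
  shows "C2_plane (R (T s c))"
proof -
  obtain D where "decay 3 D (T s c)" using T_rapid[OF assms] unfolding rapid_def by blast
  then show ?thesis by (rule R_C2_plane(1))
qed

lemma T_pde:
  assumes "s \<ge> 1" "rapid c"
  defines "u \<equiv> R (T s c)"
  shows "- pdx (pdx u) x y - pdy (pdy u) x y + a * pdx u x y + d * pdy u x y + s * u x y = \<beta> x y * R c x y"
proof -
  obtain D where D: "decay 3 D (M c)" using M_rapid[OF assms(2)] unfolding rapid_def by blast
  then have D2: "decay 2 D (M c)" by (rule decay_weaken) simp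
  obtain E where E: "decay 3 E (T s c)" using T_rapid[OF assms(1,2)] unfolding rapid_def by blast
  show ?thesis
    unfolding u_def R_C2_plane(4,5)[OF E]
    unfolding R_C2_plane(2,3)[OF E] R_M[OF assms(2), symmetric]
    using pde_G[OF assms(1) D2, of a d x y] by (simp add: T_def)
qed

text \<open>The difference \<open>v\<close> of the images solves the equation with source \<beta>
  times the difference of the inputs, so the weak principle applies. Where that source is positive,
  \<open>v\<close> cannot vanish: a zero would be a minimum, making the left-hand side nonpositive.
  The strong principle spreads this positivity to the whole plane.\<close>

lemma T_mono:
  assumes s: "s \<ge> 1" and c: "rapid c" and c': "rapid c'" and le: "\<And>x y. R c x y \<le> R c' x y"
  shows "R (T s c) x y \<le> R (T s c') x y"
    and "R c q1 q2 < R c' q1 q2 \<Longrightarrow> R (T s c) x y < R (T s c') x y"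
proof -
  define v where "v x y = R (T s c') x y - R (T s c) x y" for x y
  note j = jet2_diff[OF C2_plane_jet2[OF T_C2_plane[OF s c']] C2_plane_jet2[OF T_C2_plane[OF s c]],
      folded v_def[abs_def]]
  have cont: "cont2 v"
    using cont2_R[OF rapid_summable[OF T_rapid[OF s c]]] cont2_R[OF rapid_summable[OF T_rapid[OF s c']]]
    unfolding v_def cont2_def by (intro continuous_intros)
  have per: "periodic2 L1 L2 v"
    using periodic2_R[of "T s c"] periodic2_R[of "T s c'"] unfolding v_def periodic2_def by simp
  have eq: "- (pdx (pdx (R (T s c'))) x y - pdx (pdx (R (T s c))) x y)
      - (pdy (pdy (R (T s c'))) x y - pdy (pdy (R (T s c))) x y)
      + a * (pdx (R (T s c')) x y - pdx (R (T s c)) x y)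
      + d * (pdy (R (T s c')) x y - pdy (R (T s c)) x y) + s * v x y
      = \<beta> x y * (R c' x y - R c x y)" for x y
    using T_pde[OF s c, of x y] T_pde[OF s c', of x y] by (simp add: v_def algebra_simps)
  have pos: "\<beta> x y > 0" for x y
    using \<beta>_ge_1[of x y] by linarith
  have rhs: "\<beta> x y * (R c' x y - R c x y) \<ge> 0" for x y
    using less_imp_le[OF pos, of x y] le[of x y] by simp
  have "s > 0" using s by simp
  note sup = rhs[folded eq]
  have nonneg: "v x y \<ge> 0" for x y
    by (rule weak_maximum_principle[OF L1 L2 cont per j \<open>s > 0\<close> sup])
  then show "R (T s c) x y \<le> R (T s c') x y"
    by (simp add: v_def)
  assume q: "R c q1 q2 < R c' q1 q2"
  have "v q1 q2 > 0"
  proof (rule ccontr)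
    assume "\<not> v q1 q2 > 0"
    then have zero: "v q1 q2 = 0" using nonneg[of q1 q2] by simp
    have "v q1 q2 \<le> v x y" for x y using zero nonneg by simp
    note m = jet2_local_min[OF j zero_less_one, of q1 q2, OF this]
    have "\<beta> q1 q2 * (R c' q1 q2 - R c q1 q2) \<le> 0"
      unfolding eq[symmetric] using m zero by simp
    with q pos[of q1 q2] show False
      by (simp add: mult_le_0_iff)
  qed
  then have "v x y > 0"
    by (rule strong_maximum_principle[OF cont j \<open>s > 0\<close> sup nonneg])
  then show "R (T s c) x y < R (T s c') x y"
    by (simp add: v_def)
qed

text \<open>Each resolvent gains one power of \<open>W\<close>, so three lift bounded coefficients
  to the class in which all functions are handled. The bound depends neither on \<open>s\<close> nor
  on \<open>c\<close>, as the limit argument requires.\<close>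

lemma T_smoothing: "\<exists>D. \<forall>s\<ge>1. \<forall>c. decay 0 1 c \<longrightarrow> decay 3 D (T s (T s (T s c)))"
proof -
  obtain C0 where C0: "\<And>c D. decay 0 D c \<Longrightarrow> decay 0 (C0 * D) (M c)"
    using multiplier_decay[OF multiplier, of 0] by blast
  obtain C1 where C1: "\<And>c D. decay 1 D c \<Longrightarrow> decay 1 (C1 * D) (M c)"
    using multiplier_decay[OF multiplier, of 1] by blast
  obtain C2 where C2: "\<And>c D. decay 2 D c \<Longrightarrow> decay 2 (C2 * D) (M c)"
    using multiplier_decay[OF multiplier, of 2] by blast
  note C = C0 C1 C2
  have "decay 3 (C2 * (C1 * (C0 * 1))) (T s (T s (T s c)))" if s: "s \<ge> 1" and "decay 0 1 c" for s c
  proof -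
    have 1: "decay 1 (C0 * 1) (T s c)"
      using decay_G[OF s C(1)[OF \<open>decay 0 1 c\<close>]] by (simp add: T_def)
    have 2: "decay 2 (C1 * (C0 * 1)) (T s (T s c))"
      using decay_G[OF s C(2)[OF 1]] unfolding T_def[of s "T s c"] by (simp add: numeral_2_eq_2)
    show ?thesis
      using decay_G[OF s C(3)[OF 2]] unfolding T_def[of s "T s (T s c)"] by (simp add: numeral_3_eq_3)
  qed
  then show ?thesis by blast
qed

definition subsol :: "real \<Rightarrow> (int \<times> int \<Rightarrow> complex) \<Rightarrow> bool" where
  "subsol s c \<longleftrightarrow> herm c \<and> rapid c \<and> (\<forall>x y. R c x y \<ge> 0) \<and> (\<forall>x y. R c x y \<le> R (T s c) x y)"

text \<open>\<open>T s\<close> preserves order, so it can be applied to the inequality itself.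
  Iteration thus gains regularity while the function only increases.\<close>

lemma subsol_T:
  assumes "s \<ge> 1" "subsol s c"
  shows "subsol s (T s c)" and "R c x y \<le> R (T s c) x y"
proof -
  have c: "herm c" "rapid c" "\<And>x y. R c x y \<ge> 0" and le: "\<And>x y. R c x y \<le> R (T s c) x y"
    using assms(2) by (auto simp: subsol_def)
  then show "subsol s (T s c)"
    unfolding subsol_def
    using T_herm[OF c(1)] T_rapid[OF assms(1) c(2)] T_mono(1)[OF assms(1) c(2) T_rapid[OF assms(1) c(2)] le]
    by (meson order_trans)
  show "R c x y \<le> R (T s c) x y" by (rule le)
qed

text \<open>Take means: at frequency 0 the symbol is \<open>s\<close>, so the mean of
  \<open>T s c\<close> is that of \<beta> times \<open>R c\<close> divided by \<open>s\<close>,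
  hence at most \<open>B / s\<close> times the mean of \<open>R c\<close>.\<close>

lemma subsol_le:
  assumes "s \<ge> 1" "subsol s c" "Re (c 0) > 0"
  shows "s \<le> B"
proof -
  have c: "herm c" "rapid c" "\<And>x y. R c x y \<ge> 0" and le: "\<And>x y. R c x y \<le> R (T s c) x y"
    using assms(2) by (auto simp: subsol_def)
  have "Re (c 0) \<le> Re (T s c 0)"
    by (rule mean_mono[OF _ _ le]) (intro rapid_summable c T_rapid assms)+
  also have "Re (T s c 0) = Re (M c 0) / s"
    by (simp add: T_def G_def symb_def)
  finally have "s * Re (c 0) \<le> Re (M c 0)"
    using assms(1) by (simp add: field_simps)
  also have "Re (M c 0) \<le> Re (of_real B * c 0)"
  proof (rule mean_mono)
    show "(\<lambda>k. norm (M c k)) summable_on UNIV" "(\<lambda>k. norm (of_real B * c k)) summable_on UNIV"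
      using rapid_summable[OF M_rapid[OF c(2)]] summable_on_cmult_right[OF rapid_summable[OF c(2)], of "\<bar>B\<bar>"]
      by (simp_all add: norm_mult)
    show "R (M c) x y \<le> R (\<lambda>k. of_real B * c k) x y" for x y
      using R_M[OF c(2)] mult_right_mono[OF \<beta>_le c(3)] by (simp add: R_scale)
  qed
  finally show ?thesis
    using assms(3) by simp
qed

lemma subsol_scale:
  assumes "t \<ge> 0" "subsol s c"
  shows "subsol s (\<lambda>k. of_real t * c k)"
proof -
  have c: "herm c" "rapid c" "\<And>x y. R c x y \<ge> 0" and le: "\<And>x y. R c x y \<le> R (T s c) x y"
    using assms(2) by (auto simp: subsol_def)
  have T: "T s (\<lambda>k. of_real t * c k) = (\<lambda>k. of_real t * T s c k)"
    by (simp add: T_def multiplier_scale[OF multiplier] G_def fun_eq_iff)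
  obtain D where "decay 3 D c" using c(2) by (auto simp: rapid_def)
  then have "decay 3 (t * D) (\<lambda>k. of_real t * c k)"
    using assms(1) unfolding decay_def
    by (simp add: norm_mult mult_left_mono times_divide_eq_right[symmetric] del: times_divide_eq_right split_paired_All)
  moreover have "herm (\<lambda>k. of_real t * c k)"
    using c(1) unfolding herm_def by (simp del: split_paired_All)
  ultimately show ?thesis
    unfolding subsol_def T R_scale rapid_def using c(3) le assms(1) by (auto intro: mult_left_mono)
qed

text \<open>These are the coefficients of the constant 1. At \<open>s = 1\<close> the operator sends
  it to 1, which is at most \<beta>, so the weak maximum principle puts it below its image.\<close>

lemma subsol_one: "subsol 1 (\<lambda>k. if k = 0 then 1 else 0)"
proof -
  let ?e = "\<lambda>k :: int \<times> int. if k = 0 then 1 else 0 :: complex"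
  have ev: "ev ?e x y = 1" for x y
  proof -
    have "ev ?e x y = (\<Sum>\<^sub>\<infinity>k\<in>{0}. ?e k * ch k x y)"
      unfolding ev_def by (rule infsum_cong_neutral) auto
    then show ?thesis by simp
  qed
  have d: "decay 3 1 ?e"
    by (auto simp: decay_def W_def)
  have r: "rapid ?e" using d by (auto simp: rapid_def)
  have "1 \<le> R (T 1 ?e) x y" for x y
  proof -
    have j1: "jet2 (\<lambda>x y. 1) (\<lambda>x y. 0) (\<lambda>x y. 0) (\<lambda>x y. 0) (\<lambda>x y. 0)"
      by (simp add: jet2_def)
    note C2 = T_C2_plane[OF order_refl r]
    note j = jet2_diff[OF C2_plane_jet2[OF C2] j1]
    have "R (T 1 ?e) x y - 1 \<ge> 0"
    proof (rule weak_maximum_principle[OF L1 L2 _ _ j, of 1 a d])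
      show "cont2 (\<lambda>x y. R (T 1 ?e) x y - 1)"
        using C2 unfolding C2_plane_def C1_plane_def cont2_def by (intro continuous_intros) auto
      show "periodic2 L1 L2 (\<lambda>x y. R (T 1 ?e) x y - 1)"
        using periodic2_R[of "T 1 ?e"] unfolding periodic2_def by simp
      fix x y
      show "- (pdx (pdx (R (T 1 ?e))) x y - 0) - (pdy (pdy (R (T 1 ?e))) x y - 0)
        + a * (pdx (R (T 1 ?e)) x y - 0) + d * (pdy (R (T 1 ?e)) x y - 0) + 1 * (R (T 1 ?e) x y - 1) \<ge> 0"
        using T_pde[OF order_refl r, of x y] \<beta>_ge_1[of x y] ev[of x y] by (simp add: R_def[of ?e])
    qed simp
    then show ?thesis by simp
  qed
  then show ?thesis
    unfolding subsol_def using r ev by (auto simp: herm_def R_def[of ?e])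
qed

text \<open>The mean controls only the size of the coefficients of \<open>c n\<close>, which is too
  weak for limits of the functions. The third iterates \<open>e n\<close> are again subsolutions,
  lie above \<open>c n\<close> and share one decay bound, so they are the ones passed to the
  limit.\<close>

lemma subsol_limit:
  assumes s: "\<And>n. s n \<ge> 1" "s \<longlonglongrightarrow> s'" and c: "\<And>n. subsol (s n) (c n)" "\<And>n. c n 0 = 1"
  obtains c' where "subsol s' c'" "Re (c' 0) \<ge> 1"
proof -
  define e where "e n = T (s n) (T (s n) (T (s n) (c n)))" for n
  have s': "s' \<ge> 1"
    using LIMSEQ_le_const[OF s(2)] s(1) by blast
  have sub: "subsol (s n) (e n)" for n
    unfolding e_def by (intro subsol_T s c)
  have ge: "R (c n) x y \<le> R (e n) x y" for n x y
    unfolding e_def using subsol_T[OF s(1)] c(1) by (meson order_trans)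
  obtain D where D: "\<And>s c. s \<ge> 1 \<Longrightarrow> decay 0 1 c \<Longrightarrow> decay 3 D (T s (T s (T s c)))"
    using T_smoothing by blast
  have "norm (c n k) \<le> 1" for n k
    using coefficient_le_mean[OF rapid_summable, of "c n"] c[of n] unfolding subsol_def by auto
  then have "decay 0 1 (c n)" for n
    by (simp add: decay_def)
  then have dec: "decay 3 D (e n)" for n
    unfolding e_def by (intro D s)
  have e_bound: "norm (e n k) \<le> D" for n k
    using decay_weaken[OF dec, of 0] unfolding decay_def by (simp del: split_paired_All)
  \<comment> \<open>Diagonal extraction over the countable set of frequencies.\<close>
  obtain r :: "nat \<Rightarrow> nat" where r: "strict_mono r" "\<And>k. k \<in> UNIV \<Longrightarrow> \<exists>l. (\<lambda>n. e (r n) k) \<longlonglongrightarrow> l"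
    by (rule function_convergent_subsequence[of "UNIV :: (int \<times> int) set" e D]) (use e_bound in auto)
  then obtain c' where c': "\<And>k. (\<lambda>n. e (r n) k) \<longlonglongrightarrow> c' k"
    by (metis UNIV_I)
  have dec': "decay 3 D c'"
    unfolding decay_def
  proof
    fix k show "norm (c' k) \<le> D / W k ^ 3"
      by (rule LIMSEQ_le_const2[OF tendsto_norm[OF c']]) (use dec in \<open>unfold decay_def, blast\<close>)
  qed
  have herm: "herm c'"
    unfolding herm_def
  proof
    fix k
    have "(\<lambda>n. cnj (e (r n) k)) \<longlonglongrightarrow> cnj (c' k)"
      by (intro tendsto_intros c')
    moreover have "e (r n) (- k) = cnj (e (r n) k)" for n
      using sub[of "r n"] unfolding subsol_def herm_def by blast
    ultimately show "c' (- k) = cnj (c' k)"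
      using LIMSEQ_unique[OF c'[of "- k"]] by simp
  qed
  have lim: "(\<lambda>n. R (e (r n)) x y) \<longlonglongrightarrow> R c' x y" for x y
    unfolding R_def by (intro tendsto_Re tendsto_ev(2)[where D = D] c' decay_weaken[OF dec]) simp
  obtain C where C: "\<And>c D. decay 3 D c \<Longrightarrow> decay 3 (C * D) (M c)"
    using multiplier_decay[OF multiplier, of 3] by blast
  have "decay 2 (C * D) (T (s (r n)) (e (r n)))" for n
    unfolding T_def by (rule decay_weaken[OF decay_G[OF s(1) C[OF dec]]]) simp
  moreover have "(\<lambda>n. T (s (r n)) (e (r n)) k) \<longlonglongrightarrow> T s' c' k" for k
    unfolding T_def G_def symb_def
    by (intro tendsto_intros multiplier_tendsto[OF multiplier] c' LIMSEQ_subseq_LIMSEQ[OF s(2) r(1), unfolded o_def])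
      (use symb_nonzero[OF s'] in \<open>simp add: symb_def\<close>)
  ultimately have limT: "(\<lambda>n. R (T (s (r n)) (e (r n))) x y) \<longlonglongrightarrow> R (T s' c') x y" for x y
    unfolding R_def by (intro tendsto_Re tendsto_ev(2)[where D = "C * D"])
  show thesis
  proof
    show "subsol s' c'"
      unfolding subsol_def
    proof (intro conjI allI)
      show "herm c'" by fact
      show "rapid c'" using dec' by (auto simp: rapid_def)
      show "R c' x y \<ge> 0" for x y
        by (rule LIMSEQ_le_const[OF lim]) (use sub in \<open>auto simp: subsol_def\<close>)
      show "R c' x y \<le> R (T s' c') x y" for x y
        by (rule LIMSEQ_le[OF lim limT]) (use sub in \<open>auto simp: subsol_def\<close>)
    qed
    \<comment> \<open>Iteration may increase the mean, so the limit retains only a lower bound; this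
      rules out a vanishing limit.\<close>
    have "Re (e n 0) \<ge> 1" for n
      using mean_mono[OF rapid_summable rapid_summable ge, of n] c[of n] sub[of n]
      by (auto simp: subsol_def)
    then show "Re (c' 0) \<ge> 1"
      by (intro LIMSEQ_le_const[OF tendsto_Re[OF c']]) auto
  qed
qed

text \<open>One more application of \<open>T s\<close> turns strictness at a point into strictness
  everywhere, and compactness of the torus into a uniform gap. The resolvent varies continuously
  with \<open>s\<close> in the sup norm, so the gap pays for a slightly larger
  \<open>s\<close>.\<close>

lemma strict_subsol_improve:
  assumes s: "s \<ge> 1" and c: "subsol s c" and q: "R c q1 q2 < R (T s c) q1 q2"
  obtains s' where "s' > s" "subsol s' (T s c)"
proof -
  define w where "w = T s c"
  have rc: "rapid c" using c by (simp add: subsol_def)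
  have w: "subsol s w" unfolding w_def using s c by (rule subsol_T)
  then have rw: "rapid w" and hw: "herm w" and nw: "\<And>x y. R w x y \<ge> 0" by (auto simp: subsol_def)
  have less: "R w x y < R (T s w) x y" for x y
    unfolding w_def
    by (rule T_mono(2)[OF s rc T_rapid[OF s rc] _ q]) (use c in \<open>auto simp: subsol_def\<close>)
  define z where "z x y = R (T s w) x y - R w x y" for x y
  have "cont2 z"
    unfolding z_def using cont2_R[OF rapid_summable[OF rw]] cont2_R[OF rapid_summable[OF T_rapid[OF s rw]]]
    unfolding cont2_def by (intro continuous_intros)
  moreover have "periodic2 L1 L2 z"
    using periodic2_R[of w] periodic2_R[of "T s w"] unfolding z_def periodic2_def by simp
  ultimately obtain x0 y0 where min: "\<And>x y. z x0 y0 \<le> z x y"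
    using periodic2_attains_min[OF L1 L2] by blast
  define \<epsilon> where "\<epsilon> = z x0 y0"
  have "\<epsilon> > 0" using less[of x0 y0] by (simp add: \<epsilon>_def z_def)
  have sm: "(\<lambda>k. norm (M w k)) summable_on UNIV"
    by (intro rapid_summable M_rapid rw)
  define N where "N = (\<Sum>\<^sub>\<infinity>k. norm (M w k))"
  have "N \<ge> 0" unfolding N_def by (intro infsum_nonneg) auto
  \<comment> \<open>Replacing \<open>s\<close> by \<open>s + \<delta>\<close> changes
    \<open>R (T s w)\<close> by at most \<open>\<delta> * N\<close>, to be kept below the gap; the
    added 1 covers \<open>N = 0\<close>.\<close>
  define \<delta> where "\<delta> = \<epsilon> / (N + 1)"
  have "\<delta> > 0" using \<open>\<epsilon> > 0\<close> \<open>N \<ge> 0\<close> by (simp add: \<delta>_def)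
  have "\<delta> * N \<le> \<epsilon>" using \<open>\<epsilon> > 0\<close> \<open>N \<ge> 0\<close> by (simp add: \<delta>_def field_simps)
  have s': "s + \<delta> \<ge> 1" using s \<open>\<delta> > 0\<close> by simp
  define f where "f k = T s w k - T (s + \<delta>) w k" for k
  have fk: "norm (f k) \<le> \<delta> * norm (M w k)" for k
  proof -
    have eq: "symb a d (s + \<delta>) k = symb a d s k + of_real \<delta>"
      by (simp add: symb_def)
    have "f k = of_real \<delta> * (M w k / (symb a d s k * symb a d (s + \<delta>) k))"
      using symb_nonzero[OF s, of a d k] symb_nonzero[OF s', of a d k] unfolding eq f_def T_def G_def
      by (simp add: field_simps)
    then have "norm (f k) = \<delta> * norm (M w k) / (norm (symb a d s k) * norm (symb a d (s + \<delta>) k))"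
      using \<open>\<delta> > 0\<close> by (simp add: norm_mult norm_divide)
    also have "\<dots> \<le> \<delta> * norm (M w k) / (1 * 1)"
    proof -
      have "norm (symb a d s k) \<ge> 1" "norm (symb a d (s + \<delta>) k) \<ge> 1"
        using norm_symb_ge[OF s, of k a d] norm_symb_ge[OF s', of k a d] W_ge_1[of k] by linarith+
      then show ?thesis
        using \<open>\<delta> > 0\<close> by (intro frac_le mult_mono) simp_all
    qed
    finally show ?thesis by simp
  qed
  have fs: "(\<lambda>k. norm (f k)) summable_on UNIV"
    by (rule summable_on_comparison_test[OF summable_on_cmult_right[OF sm] fk]) simp
  have "R f x y = R (T s w) x y - R (T (s + \<delta>) w) x y" for x y
  proof -
    have "((\<lambda>k. f k * ch k x y) has_sum (ev (T s w) x y - ev (T (s + \<delta>) w) x y)) UNIV"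
      unfolding f_def left_diff_distrib
      unfolding diff_conv_add_uminus
      by (intro has_sum_add has_sum_neg has_sum_ev rapid_summable T_rapid s s' rw)
    then have "ev f x y = ev (T s w) x y - ev (T (s + \<delta>) w) x y"
      by (simp add: ev_def infsumI)
    then show ?thesis by (simp add: R_def)
  qed
  moreover have "R f x y \<le> \<epsilon>" for x y
  proof -
    have "R f x y \<le> norm (ev f x y)" unfolding R_def by (rule complex_Re_le_cmod)
    also have "\<dots> \<le> (\<Sum>\<^sub>\<infinity>k. norm (f k))" by (rule norm_ev_le[OF fs])
    also have "\<dots> \<le> (\<Sum>\<^sub>\<infinity>k. \<delta> * norm (M w k))"
      by (rule infsum_mono[OF fs summable_on_cmult_right[OF sm] fk])
    also have "\<dots> = \<delta> * N" unfolding N_def by (rule infsum_cmult_right')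
    finally show ?thesis using \<open>\<delta> * N \<le> \<epsilon>\<close> by simp
  qed
  ultimately have "R w x y \<le> R (T (s + \<delta>) w) x y" for x y
    using min[of x y] by (simp add: \<epsilon>_def z_def) (smt (verit))
  then have "subsol (s + \<delta>) w"
    using rw hw nw by (simp add: subsol_def)
  then show thesis
    using that[of "s + \<delta>"] \<open>\<delta> > 0\<close> by (simp add: w_def)
qed

lemma exists_eigenfunction:
  obtains u s where "C2_plane u" "periodic2 L1 L2 u" "\<And>x y. u x y > 0"
    "\<And>x y. - pdx (pdx u) x y - pdy (pdy u) x y + a * pdx u x y + d * pdy u x y + s * u x y = \<beta> x y * u x y"
proof -
  define S where "S = {s. s \<ge> 1 \<and> (\<exists>c. subsol s c \<and> c 0 = 1)}"
  have normalise: "s \<in> S" if "s \<ge> 1" "subsol s c" "Re (c 0) > 0" for s c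
  proof -
    have "c 0 = of_real (Re (c 0))"
      using that(2) unfolding subsol_def herm_def by (metis Reals_cnj_iff minus_zero of_real_Re)
    then have "of_real (inverse (Re (c 0))) * c 0 = 1"
      using that(3) by (metis left_inverse less_irrefl of_real_1 of_real_mult)
    moreover have "subsol s (\<lambda>k. of_real (inverse (Re (c 0))) * c k)"
      using that by (intro subsol_scale) auto
    ultimately show ?thesis
      using that(1) unfolding S_def by blast
  qed
  have "1 \<in> S" using normalise[OF _ subsol_one] by simp
  moreover have "s \<le> B" if "s \<in> S" for s
    using that subsol_le unfolding S_def by fastforce
  then have bdd: "bdd_above S" by (auto simp: bdd_above_def)
  ultimately have "Sup S \<in> closure S"
    by (intro closure_contains_Sup) auto
  then obtain \<sigma> where \<sigma>: "\<And>n. \<sigma> n \<in> S" "\<sigma> \<longlonglongrightarrow> Sup S"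
    unfolding closure_sequential by blast
  define s where "s = Sup S"
  have s: "s \<ge> 1" unfolding s_def using \<open>1 \<in> S\<close> bdd by (rule cSup_upper)
  have "\<forall>n. \<exists>c. subsol (\<sigma> n) c \<and> c 0 = 1" and \<sigma>1: "\<And>n. \<sigma> n \<ge> 1"
    using \<sigma>(1) by (auto simp: S_def)
  then obtain \<gamma> where "\<And>n. subsol (\<sigma> n) (\<gamma> n)" "\<And>n. \<gamma> n 0 = 1"
    by metis
  then obtain c where c: "subsol s c" "Re (c 0) \<ge> 1"
    using subsol_limit[OF \<sigma>1 \<sigma>(2)] unfolding s_def by metis
  have rc: "rapid c" and nc: "\<And>x y. R c x y \<ge> 0" using c(1) by (auto simp: subsol_def)
  have eq: "R (T s c) x y = R c x y" for x y
  proof (rule ccontr)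
    assume "R (T s c) x y \<noteq> R c x y"
    then have "R c x y < R (T s c) x y"
      using subsol_T(2)[OF s c(1), of x y] by simp
    then obtain s' where s': "s' > s" "subsol s' (T s c)"
      using strict_subsol_improve[OF s c(1)] by blast
    \<comment> \<open>The image dominates \<open>c\<close>, so its mean stays positive; after
      normalisation the improved level lies in \<open>S\<close>, against maximality.\<close>
    have "Re (c 0) \<le> Re (T s c 0)"
      by (rule mean_mono) (intro rapid_summable rc T_rapid s subsol_T(2)[OF s c(1)])+
    then have "s' \<in> S"
      using s' s c(2) by (intro normalise[of _ "T s c"]) auto
    then have "s' \<le> s" unfolding s_def using bdd by (rule cSup_upper)
    with s' show False by simp
  qed
  \<comment> \<open>This equals \<open>R c\<close> as a function, which turns the resolvent equation
    with source \<open>R c\<close> into the eigenvalue equation.\<close>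
  define u where "u = R (T s c)"
  have pde: "- pdx (pdx u) x y - pdy (pdy u) x y + a * pdx u x y + d * pdy u x y + s * u x y = \<beta> x y * u x y" for x y
    using T_pde[OF s rc, of x y] eq[of x y] by (simp add: u_def)
  have C2: "C2_plane u" unfolding u_def by (rule T_C2_plane[OF s rc])
  have nu: "u x y \<ge> 0" for x y using nc eq by (simp add: u_def)
  have "\<exists>q1 q2. u q1 q2 > 0"
  proof (rule ccontr)
    assume "\<not> ?thesis"
    then have le: "u x y \<le> 0" for x y
      by (simp add: not_less)
    have "R c x y \<le> R (\<lambda>k. 0) x y" for x y
      using eq[of x y] le[of x y] by (simp add: u_def R_def[of "\<lambda>k. 0"] ev_def)
    from mean_mono[OF rapid_summable[OF rc] _ this] c(2) show False by simp
  qed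
  then obtain q1 q2 where q: "u q1 q2 > 0" by blast
  have "u x y > 0" for x y
  proof (rule strong_maximum_principle[OF _ C2_plane_jet2[OF C2], of s a d q1 q2])
    show "cont2 u" using C2 by (simp add: C2_plane_def C1_plane_def)
    show "- pdx (pdx u) x y - pdy (pdy u) x y + a * pdx u x y + d * pdy u x y + s * u x y \<ge> 0" for x y
      unfolding pde using nu[of x y] \<beta>_ge_1[of x y] by simp
  qed (use s nu q in auto)
  moreover have "periodic2 L1 L2 u" unfolding u_def by (rule periodic2_R)
  ultimately show thesis
    using that[OF C2 _ _ pde] by blast
qed

end

lemma (in torus) exists_principal_eig:
  assumes "multiplier M b" "\<And>x y. b x y \<ge> 1" "\<And>x y. b x y \<le> B"
  shows "\<exists>\<mu>. is_principal_eig L1 L2 lam \<theta> (\<lambda>x y. b x y - 1) \<mu>"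
proof -
  interpret torus_operator L1 L2 "2 * lam * cos \<theta>" "2 * lam * sin \<theta>" M b B
    by unfold_locales fact+
  obtain u s where u: "C2_plane u" "periodic2 L1 L2 u" "\<And>x y. u x y > 0"
    "\<And>x y. - pdx (pdx u) x y - pdy (pdy u) x y + 2 * lam * cos \<theta> * pdx u x y + 2 * lam * sin \<theta> * pdy u x y
      + s * u x y = b x y * u x y"
    using exists_eigenfunction by blast
  have "is_principal_eig L1 L2 lam \<theta> (\<lambda>x y. b x y - 1) (1 - s)"
    unfolding is_principal_eig_def
  proof (intro exI conjI allI)
    fix x y
    show "- pdx (pdx u) x y - pdy (pdy u) x y + 2 * lam * cos \<theta> * pdx u x y
        + 2 * lam * sin \<theta> * pdy u x y - (b x y - 1) * u x y = (1 - s) * u x y"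
      using u(4)[of x y] by (simp add: algebra_simps)
  qed (use u in auto)
  then show ?thesis by blast
qed

section \<open>A lower bound for the wave speed\<close>

context torus
begin

abbreviation box :: "(real \<times> real) set" where "box \<equiv> cbox (0, 0) (L1, L2)"

lemma cont2_integrable: "cont2 f \<Longrightarrow> (\<lambda>p. f (fst p) (snd p)) integrable_on box"
  unfolding cont2_def by (intro integrable_continuous) (rule continuous_on_subset, auto)

lemma integral_dy_zero:
  assumes "\<And>x y. ((\<lambda>t. F x t) has_real_derivative Fy x y) (at y)" "cont2 Fy" "\<And>x. F x L2 = F x 0"
  shows "integral box (\<lambda>p. Fy (fst p) (snd p)) = 0"
proof -
  have "(Fy x has_integral (F x L2 - F x 0)) {0..L2}" for x
    by (rule fundamental_theorem_of_calculus)
      (use assms(1) L2 in \<open>auto simp: has_real_derivative_iff_has_vector_derivative[symmetric] intro: has_field_derivative_at_within\<close>)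
  then have "integral (cbox 0 L2) (Fy x) = 0" for x
    using assms(3) by (simp add: integral_unique)
  moreover have "integral box (\<lambda>p. Fy (fst p) (snd p)) = integral (cbox 0 L1) (\<lambda>x. integral (cbox 0 L2) (\<lambda>y. Fy x y))"
    by (subst integral_prod_continuous) (use assms(2) in \<open>auto simp: cont2_def intro: continuous_on_subset\<close>)
  ultimately show ?thesis by simp
qed

lemma integral_dx_zero:
  assumes "\<And>x y. ((\<lambda>s. F s y) has_real_derivative Fx x y) (at x)" "cont2 Fx" "\<And>y. F L1 y = F 0 y"
  shows "integral box (\<lambda>p. Fx (fst p) (snd p)) = 0"
proof -
  have "((\<lambda>x. Fx x y) has_integral (F L1 y - F 0 y)) {0..L1}" for y
    by (rule fundamental_theorem_of_calculus)
      (use assms(1) L1 in \<open>auto simp: has_real_derivative_iff_has_vector_derivative[symmetric] intro: has_field_derivative_at_within\<close>)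
  then have z: "integral (cbox 0 L1) (\<lambda>x. Fx x y) = 0" for y
    using assms(3) by (simp add: integral_unique)
  have cont: "continuous_on box (\<lambda>p. Fx (fst p) (snd p))"
    using assms(2) by (auto simp: cont2_def intro: continuous_on_subset)
  then have "integral box (\<lambda>p. Fx (fst p) (snd p)) = integral (cbox 0 L1) (\<lambda>x. integral (cbox 0 L2) (\<lambda>y. Fx x y))"
    by (subst integral_prod_continuous) auto
  also have "\<dots> = integral (cbox 0 L2) (\<lambda>y. integral (cbox 0 L1) (\<lambda>x. Fx x y))"
    using cont by (intro integral_swap_continuous) (simp add: case_prod_unfold)
  finally show ?thesis by (simp only: z integral_0)
qed

text \<open>With \<open>P = \<nabla>u / u - \<lambda>e\<close> the eigenvalue equation reads \<open>\<lambda>\<^sup>2 - \<mu> = div P + |P|\<^sup>2 + b\<close>. Multiplying by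
  \<open>\<phi>\<^sup>2\<close>, the defect of the inequality is the integral of \<open>|\<phi> P - \<nabla>\<phi>|\<^sup>2\<close>.\<close>

lemma principal_eig_variational:
  fixes \<phi> \<phi>x \<phi>y :: "real \<Rightarrow> real \<Rightarrow> real"
  assumes "is_principal_eig L1 L2 lam \<theta> b \<mu>" and "cont2 b"
    and d: "\<And>x y. ((\<lambda>s. \<phi> s y) has_real_derivative \<phi>x x y) (at x)"
           "\<And>x y. ((\<lambda>t. \<phi> x t) has_real_derivative \<phi>y x y) (at y)"
    and c: "cont2 \<phi>" "cont2 \<phi>x" "cont2 \<phi>y" and per: "periodic2 L1 L2 \<phi>"
  shows "integral box (\<lambda>p. b (fst p) (snd p) * (\<phi> (fst p) (snd p))\<^sup>2) \<le>
    (lam\<^sup>2 - \<mu>) * integral box (\<lambda>p. (\<phi> (fst p) (snd p))\<^sup>2) +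
    integral box (\<lambda>p. (\<phi>x (fst p) (snd p))\<^sup>2) + integral box (\<lambda>p. (\<phi>y (fst p) (snd p))\<^sup>2)"
proof -
  obtain u where u: "C2_plane u" "periodic2 L1 L2 u" "\<And>x y. u x y > 0"
      "\<And>x y. - pdx (pdx u) x y - pdy (pdy u) x y + 2 * lam * cos \<theta> * pdx u x y
               + 2 * lam * sin \<theta> * pdy u x y - b x y * u x y = \<mu> * u x y"
    using assms(1) unfolding is_principal_eig_def by blast
  note j = C2_plane_jet2[OF u(1), unfolded jet2_def, rule_format]
  have cu: "cont2 u" "cont2 (pdx u)" "cont2 (pdy u)" "cont2 (pdx (pdx u))" "cont2 (pdy (pdy u))"
    using u(1) unfolding C2_plane_def C1_plane_def by auto
  have u0: "u x y \<noteq> 0" for x y using u(3)[of x y] by simp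
  define P where "P x y = pdx u x y / u x y - lam * cos \<theta>" for x y
  define Q where "Q x y = pdy u x y / u x y - lam * sin \<theta>" for x y
  define Px where "Px x y = (pdx (pdx u) x y * u x y - pdx u x y * pdx u x y) / (u x y * u x y)" for x y
  define Qy where "Qy x y = (pdy (pdy u) x y * u x y - pdy u x y * pdy u x y) / (u x y * u x y)" for x y
  have dP: "((\<lambda>s. P s y) has_real_derivative Px x y) (at x)" for x y
    unfolding P_def Px_def using j u0 by (auto intro!: derivative_eq_intros)
  have dQ: "((\<lambda>t. Q x t) has_real_derivative Qy x y) (at y)" for x y
    unfolding Q_def Qy_def using j u0 by (auto intro!: derivative_eq_intros)
  \<comment> \<open>\<open>F\<close> and \<open>H\<close> are the x-derivative of
    \<open>\<phi>\<^sup>2 * P\<close> and the y-derivative of \<open>\<phi>\<^sup>2 * Q\<close>, so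
    both integrate to zero over a period.\<close>
  define F where "F x y = 2 * \<phi> x y * \<phi>x x y * P x y + (\<phi> x y)\<^sup>2 * Px x y" for x y
  define H where "H x y = 2 * \<phi> x y * \<phi>y x y * Q x y + (\<phi> x y)\<^sup>2 * Qy x y" for x y
  have cPQ: "cont2 P" "cont2 Q" "cont2 Px" "cont2 Qy"
    unfolding P_def Q_def Px_def Qy_def cont2_def
    using cu u0 unfolding cont2_def by (auto intro!: continuous_intros)
  have cF: "cont2 F" "cont2 H"
    unfolding F_def H_def cont2_def
    using cPQ c unfolding cont2_def by (auto intro!: continuous_intros)
  have pu: "pdx u (x + L1) y = pdx u x y" "pdy u x (y + L2) = pdy u x y" for x y
  proof -
    have "((\<lambda>s. u (s + L1) y) has_real_derivative pdx u (x + L1) y) (at x)"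
      by (rule iffD1[OF DERIV_shift[of "\<lambda>s. u s y"]]) (rule j[THEN conjunct1])
    then have "((\<lambda>s. u s y) has_real_derivative pdx u (x + L1) y) (at x)"
      using u(2) by (simp add: periodic2_def)
    then show "pdx u (x + L1) y = pdx u x y"
      using j[THEN conjunct1] by (rule DERIV_unique)
    have "((\<lambda>t. u x (t + L2)) has_real_derivative pdy u x (y + L2)) (at y)"
      by (rule iffD1[OF DERIV_shift[of "u x"]]) (rule j[THEN conjunct2, THEN conjunct1])
    then have "((\<lambda>t. u x t) has_real_derivative pdy u x (y + L2)) (at y)"
      using u(2) by (simp add: periodic2_def)
    then show "pdy u x (y + L2) = pdy u x y"
      using j[THEN conjunct2, THEN conjunct1] by (rule DERIV_unique)
  qed
  have bd: "(\<phi> L1 y)\<^sup>2 * P L1 y = (\<phi> 0 y)\<^sup>2 * P 0 y" "(\<phi> x L2)\<^sup>2 * Q x L2 = (\<phi> x 0)\<^sup>2 * Q x 0" for x y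
    using pu(1)[of 0 y] pu(2)[of x 0] u(2)[unfolded periodic2_def, rule_format, of 0 y]
      u(2)[unfolded periodic2_def, rule_format, of x 0]
      per[unfolded periodic2_def, rule_format, of 0 y] per[unfolded periodic2_def, rule_format, of x 0]
    by (simp_all add: P_def Q_def)
  have "((\<lambda>s. (\<phi> s y)\<^sup>2 * P s y) has_real_derivative F x y) (at x)" for x y
    unfolding F_def by (auto intro!: derivative_eq_intros d dP simp: power2_eq_square algebra_simps)
  then have iF: "integral box (\<lambda>p. F (fst p) (snd p)) = 0"
    using cF(1) bd(1) by (rule integral_dx_zero)
  have "((\<lambda>t. (\<phi> x t)\<^sup>2 * Q x t) has_real_derivative H x y) (at y)" for x y
    unfolding H_def by (auto intro!: derivative_eq_intros d dQ simp: power2_eq_square algebra_simps)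
  then have iH: "integral box (\<lambda>p. H (fst p) (snd p)) = 0"
    using cF(2) bd(2) by (rule integral_dy_zero)
  have k: "lam\<^sup>2 - \<mu> = Px x y + Qy x y + (P x y)\<^sup>2 + (Q x y)\<^sup>2 + b x y" for x y
  proof -
    have "\<mu> = (- pdx (pdx u) x y - pdy (pdy u) x y + 2 * lam * cos \<theta> * pdx u x y
               + 2 * lam * sin \<theta> * pdy u x y) / u x y - b x y"
      using u(4)[of x y] u0[of x y] by (simp add: field_simps)
    moreover have "lam\<^sup>2 = (lam * cos \<theta>)\<^sup>2 + (lam * sin \<theta>)\<^sup>2"
      by (simp add: power_mult_distrib flip: distrib_left)
    ultimately show ?thesis
      using u0[of x y] by (simp add: P_def Q_def Px_def Qy_def power2_diff) (simp add: field_simps power2_eq_square)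
  qed
  have point: "b x y * (\<phi> x y)\<^sup>2 + F x y + H x y \<le> (lam\<^sup>2 - \<mu>) * (\<phi> x y)\<^sup>2 + (\<phi>x x y)\<^sup>2 + (\<phi>y x y)\<^sup>2" for x y
  proof -
    have "(lam\<^sup>2 - \<mu>) * (\<phi> x y)\<^sup>2 + (\<phi>x x y)\<^sup>2 + (\<phi>y x y)\<^sup>2 - (b x y * (\<phi> x y)\<^sup>2 + F x y + H x y)
      = (\<phi> x y * P x y - \<phi>x x y)\<^sup>2 + (\<phi> x y * Q x y - \<phi>y x y)\<^sup>2"
      unfolding k[of x y] F_def H_def by (simp add: power2_eq_square algebra_simps)
    then show ?thesis
      using zero_le_power2[of "\<phi> x y * P x y - \<phi>x x y"] zero_le_power2[of "\<phi> x y * Q x y - \<phi>y x y"] by linarith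
  qed
  have hi: "((\<lambda>p. f (fst p) (snd p)) has_integral integral box (\<lambda>p. f (fst p) (snd p))) box" if "cont2 f" for f
    using cont2_integrable[OF that] by (rule integrable_integral)
  have c2: "cont2 (\<lambda>x y. b x y * (\<phi> x y)\<^sup>2)" "cont2 (\<lambda>x y. (\<phi> x y)\<^sup>2)"
    "cont2 (\<lambda>x y. (\<phi>x x y)\<^sup>2)" "cont2 (\<lambda>x y. (\<phi>y x y)\<^sup>2)"
    using assms(2) c unfolding cont2_def by (auto intro!: continuous_intros)
  have "integral box (\<lambda>p. b (fst p) (snd p) * (\<phi> (fst p) (snd p))\<^sup>2) + integral box (\<lambda>p. F (fst p) (snd p))
      + integral box (\<lambda>p. H (fst p) (snd p)) \<le>
    (lam\<^sup>2 - \<mu>) * integral box (\<lambda>p. (\<phi> (fst p) (snd p))\<^sup>2) +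
    integral box (\<lambda>p. (\<phi>x (fst p) (snd p))\<^sup>2) + integral box (\<lambda>p. (\<phi>y (fst p) (snd p))\<^sup>2)"
    by (rule has_integral_le[OF has_integral_add[OF has_integral_add[OF hi[OF c2(1)] hi[OF cF(1)]] hi[OF cF(2)]]
        has_integral_add[OF has_integral_add[OF has_integral_mult_right[OF hi[OF c2(2)]] hi[OF c2(3)]] hi[OF c2(4)]]])
      (rule point)
  then show ?thesis by (simp add: iF iH)
qed

section \<open>Multiplication by trigonometric polynomials\<close>

text \<open>An existential stand-in for trigonometric polynomials: it holds for lattice cosines and
  is closed under scaling, sums and products, with no coefficient bookkeeping.\<close>

definition trig :: "(real \<Rightarrow> real \<Rightarrow> real) \<Rightarrow> bool" where
  "trig b \<longleftrightarrow> (\<exists>M. multiplier M b)"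

lemma trig_1: "trig (\<lambda>x y. 1)"
  unfolding trig_def multiplier_def by (intro exI[of _ "\<lambda>c. c"]) (auto intro!: exI[of _ 1])

lemma trig_scale:
  assumes "trig b"
  shows "trig (\<lambda>x y. r * b x y)"
proof -
  obtain M where M: "multiplier M b" using assms by (auto simp: trig_def)
  have "multiplier (\<lambda>c k. of_real r * M c k) (\<lambda>x y. r * b x y)"
    unfolding multiplier_def
  proof (intro conjI allI impI)
    fix p
    obtain C where C: "C \<ge> 0" "\<And>c D. decay p D c \<Longrightarrow> decay p (C * D) (M c)"
      using multiplier_decay[OF M] by blast
    have "decay p (\<bar>r\<bar> * C * D) (\<lambda>k. of_real r * M c k)" if "decay p D c" for c D
      unfolding decay_def
    proof
      fix k
      have "norm (M c k) \<le> C * D / W k ^ p" using C(2)[OF that] unfolding decay_def by blast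
      from mult_left_mono[OF this, of "\<bar>r\<bar>"]
      show "norm (of_real r * M c k) \<le> \<bar>r\<bar> * C * D / W k ^ p" by (simp add: norm_mult mult.assoc)
    qed
    then show "\<exists>C\<ge>0. \<forall>c D. decay p D c \<longrightarrow> decay p (C * D) (\<lambda>k. of_real r * M c k)"
      using C(1) by (intro exI[of _ "\<bar>r\<bar> * C"]) auto
  next
    fix c assume "herm c"
    then have "herm (M c)" by (rule multiplier_herm[OF M])
    then show "herm (\<lambda>k. of_real r * M c k)" by (simp add: herm_def)
  next
    fix c D x y assume "decay 2 D c"
    then show "R (\<lambda>k. of_real r * M c k) x y = r * b x y * R c x y"
      by (simp add: R_scale multiplier_R[OF M])
  next
    fix cs :: "nat \<Rightarrow> int \<times> int \<Rightarrow> complex" and c k assume "\<forall>k. (\<lambda>n. cs n k) \<longlonglongrightarrow> c k"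
    then have "(\<lambda>n. M (cs n) k) \<longlonglongrightarrow> M c k" by (intro multiplier_tendsto[OF M]) blast
    then show "(\<lambda>n. of_real r * M (cs n) k) \<longlonglongrightarrow> of_real r * M c k" by (intro tendsto_intros)
  qed (simp add: multiplier_scale[OF M] mult.left_commute)
  then show ?thesis unfolding trig_def by blast
qed

lemma R_add:
  assumes "(\<lambda>k. norm (c k)) summable_on UNIV" "(\<lambda>k. norm (c' k)) summable_on UNIV"
  shows "R (\<lambda>k. c k + c' k) x y = R c x y + R c' x y"
proof -
  have "((\<lambda>k. (c k + c' k) * ch k x y) has_sum (ev c x y + ev c' x y)) UNIV"
    unfolding distrib_right by (intro has_sum_add has_sum_ev assms)
  then show ?thesis
    by (simp add: R_def ev_def infsumI)
qed

lemma trig_add: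
  assumes "trig b" "trig b'"
  shows "trig (\<lambda>x y. b x y + b' x y)"
proof -
  obtain M M' where M: "multiplier M b" "multiplier M' b'" using assms by (auto simp: trig_def)
  have "multiplier (\<lambda>c k. M c k + M' c k) (\<lambda>x y. b x y + b' x y)"
    unfolding multiplier_def
  proof (intro conjI allI impI)
    fix p
    obtain C where C: "C \<ge> 0" "\<And>c D. decay p D c \<Longrightarrow> decay p (C * D) (M c)"
      using multiplier_decay[OF M(1)] by blast
    obtain C' where C': "C' \<ge> 0" "\<And>c D. decay p D c \<Longrightarrow> decay p (C' * D) (M' c)"
      using multiplier_decay[OF M(2)] by blast
    have "decay p ((C + C') * D) (\<lambda>k. M c k + M' c k)" if "decay p D c" for c D
      unfolding decay_def
    proof
      fix k
      have "norm (M c k) \<le> C * D / W k ^ p" "norm (M' c k) \<le> C' * D / W k ^ p"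
        using C(2)[OF that] C'(2)[OF that] unfolding decay_def by blast+
      then have "norm (M c k + M' c k) \<le> C * D / W k ^ p + C' * D / W k ^ p"
        by (rule norm_triangle_mono)
      then show "norm (M c k + M' c k) \<le> (C + C') * D / W k ^ p"
        by (simp add: distrib_right add_divide_distrib)
    qed
    then show "\<exists>C\<ge>0. \<forall>c D. decay p D c \<longrightarrow> decay p (C * D) (\<lambda>k. M c k + M' c k)"
      using C(1) C'(1) by (intro exI[of _ "C + C'"]) auto
  next
    fix c assume "herm c"
    then have "herm (M c)" "herm (M' c)" by (rule M[THEN multiplier_herm])+
    then show "herm (\<lambda>k. M c k + M' c k)" by (simp add: herm_def)
  next
    fix c D x y assume c: "decay 2 D c"
    have "(\<lambda>k. norm (M c k)) summable_on UNIV" "(\<lambda>k. norm (M' c k)) summable_on UNIV"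
      using multiplier_decay[OF M(1), of 2] multiplier_decay[OF M(2), of 2] c decay_summable by blast+
    then show "R (\<lambda>k. M c k + M' c k) x y = (b x y + b' x y) * R c x y"
      using M[THEN multiplier_R, OF c] by (simp add: R_add distrib_right)
  next
    fix cs :: "nat \<Rightarrow> int \<times> int \<Rightarrow> complex" and c k assume "\<forall>k. (\<lambda>n. cs n k) \<longlonglongrightarrow> c k"
    then have "(\<lambda>n. M (cs n) k) \<longlonglongrightarrow> M c k" "(\<lambda>n. M' (cs n) k) \<longlonglongrightarrow> M' c k"
      by (intro M[THEN multiplier_tendsto]; blast)+
    then show "(\<lambda>n. M (cs n) k + M' (cs n) k) \<longlonglongrightarrow> M c k + M' c k" by (intro tendsto_intros)
  qed (simp add: M[THEN multiplier_scale] distrib_left)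
  then show ?thesis unfolding trig_def by blast
qed

lemma trig_mult:
  assumes "trig b" "trig b'"
  shows "trig (\<lambda>x y. b x y * b' x y)"
proof -
  obtain M M' where M: "multiplier M b" "multiplier M' b'" using assms by (auto simp: trig_def)
  have "multiplier (\<lambda>c. M (M' c)) (\<lambda>x y. b x y * b' x y)"
    unfolding multiplier_def
  proof (intro conjI allI impI)
    fix p
    obtain C where C: "C \<ge> 0" "\<And>c D. decay p D c \<Longrightarrow> decay p (C * D) (M c)"
      using multiplier_decay[OF M(1)] by blast
    obtain C' where C': "C' \<ge> 0" "\<And>c D. decay p D c \<Longrightarrow> decay p (C' * D) (M' c)"
      using multiplier_decay[OF M(2)] by blast
    have "decay p (C * C' * D) (M (M' c))" if "decay p D c" for c D
      using C(2)[OF C'(2)[OF that]] by (simp add: mult.assoc)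
    then show "\<exists>C\<ge>0. \<forall>c D. decay p D c \<longrightarrow> decay p (C * D) (M (M' c))"
      using C(1) C'(1) by (intro exI[of _ "C * C'"]) auto
  next
    fix c assume "herm c"
    then show "herm (M (M' c))" by (intro M[THEN multiplier_herm])
  next
    fix c D x y assume c: "decay 2 D c"
    obtain E where "decay 2 E (M' c)" using multiplier_decay[OF M(2), of 2] c by blast
    then show "R (M (M' c)) x y = b x y * b' x y * R c x y"
      by (simp add: multiplier_R[OF M(1)] multiplier_R[OF M(2) c])
  next
    fix cs :: "nat \<Rightarrow> int \<times> int \<Rightarrow> complex" and c k assume "\<forall>k. (\<lambda>n. cs n k) \<longlonglongrightarrow> c k"
    then have "(\<lambda>n. M' (cs n) k) \<longlonglongrightarrow> M' c k" for k
      by (intro multiplier_tendsto[OF M(2)]) blast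
    then show "(\<lambda>n. M (M' (cs n)) k) \<longlonglongrightarrow> M (M' c) k"
      by (rule multiplier_tendsto[OF M(1)])
  qed (simp add: M[THEN multiplier_scale])
  then show ?thesis unfolding trig_def by blast
qed

lemma trig_power:
  assumes "trig b"
  shows "trig (\<lambda>x y. b x y ^ n)"
  by (induction n) (auto intro!: trig_1 trig_mult assms)

text \<open>Peetre's inequality; it makes frequency shifts preserve every decay class.\<close>

lemma W_shift: "W k \<le> 4 * W j * W (k + j)"
proof -
  have sq: "t\<^sup>2 \<le> 2 * (t + u)\<^sup>2 + 2 * u\<^sup>2" for t u :: real
    using zero_le_power2[of "t + 2 * u"] by (simp add: power2_eq_square algebra_simps)
  have "W k \<le> 2 * W (k + j) + 2 * W j"
    using sq[of "kx k" "kx j"] sq[of "ky k" "ky j"] by (simp add: W_def)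
  also have "\<dots> \<le> 4 * W j * W (k + j)"
  proof -
    have "W (k + j) \<le> W j * W (k + j)" "W j \<le> W j * W (k + j)"
      using W_ge_1[of j] W_ge_1[of "k + j"] by simp_all
    then have "2 * W (k + j) + 2 * W j \<le> 4 * (W j * W (k + j))" by linarith
    then show ?thesis by (simp only: mult.assoc)
  qed
  finally show ?thesis .
qed

lemma decay_shift:
  assumes "decay p D c"
  shows "decay p ((4 * W j) ^ p * D) (\<lambda>k. c (k + j))"
  unfolding decay_def
proof
  fix k
  have "norm (c (k + j)) \<le> D / W (k + j) ^ p"
    using assms unfolding decay_def by blast
  also have "\<dots> \<le> (4 * W j) ^ p * D / W k ^ p"
  proof -
    have "W k ^ p \<le> (4 * W j) ^ p * W (k + j) ^ p"
      unfolding power_mult_distrib[symmetric]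
      by (rule power_mono[OF W_shift]) (simp add: less_imp_le)
    from mult_left_mono[OF this decay_nonneg[OF assms]] show ?thesis
      by (simp add: divide_le_eq le_divide_eq mult_ac)
  qed
  finally show "norm (c (k + j)) \<le> (4 * W j) ^ p * D / W k ^ p" .
qed

text \<open>A cosine is half the sum of two conjugate characters, so multiplication by it averages
  two opposite shifts of the coefficients.\<close>

lemma trig_cos: "trig (\<lambda>x y. cos (kx j * x + ky j * y))"
proof -
  let ?M = "\<lambda>c k. (c (k + j) + c (k + - j)) / 2 :: complex"
  have W: "W (- j) = W j" by (simp add: W_def)
  have "multiplier ?M (\<lambda>x y. cos (kx j * x + ky j * y))"
    unfolding multiplier_def
  proof (intro conjI allI impI)
    fix p
    have "decay p ((4 * W j) ^ p * D) (?M c)" if "decay p D c" for c D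
      unfolding decay_def
    proof
      fix k
      define E where "E = (4 * W j) ^ p * D / W k ^ p"
      have "norm (c (k + j)) \<le> E" "norm (c (k + - j)) \<le> E"
        using decay_shift[OF that, of j] decay_shift[OF that, of "- j"] unfolding decay_def W E_def by blast+
      then have "norm (c (k + j) + c (k + - j)) \<le> E + E"
        by (rule norm_triangle_mono)
      then show "norm (?M c k) \<le> (4 * W j) ^ p * D / W k ^ p"
        unfolding E_def[symmetric] by (simp add: norm_divide)
    qed
    then show "\<exists>C\<ge>0. \<forall>c D. decay p D c \<longrightarrow> decay p (C * D) (?M c)"
      by (intro exI[of _ "(4 * W j) ^ p"]) (simp add: less_imp_le)
  next
    fix c assume "herm c"
    then have h: "\<And>k. c (- k) = cnj (c k)" unfolding herm_def by blast
    show "herm (?M c)"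
      unfolding herm_def
    proof
      fix k
      show "?M c (- k) = cnj (?M c k)"
        using h[of "k + j"] h[of "k + - j"] by (simp add: add.commute)
    qed
  next
    fix c D x y assume c: "decay 2 D c"
    have "((\<lambda>k. (c (k + j) * ch k x y + c (k + - j) * ch k x y) / 2) has_sum
        ((ev (\<lambda>k. c (k + j)) x y + ev (\<lambda>k. c (k + - j)) x y) / 2)) UNIV"
      using decay_shift[OF c] by (intro has_sum_divide_const has_sum_add has_sum_ev decay_summable)
    moreover have "(c (k + j) * ch k x y + c (k + - j) * ch k x y) / 2 = ?M c k * ch k x y" for k
      by (simp add: distrib_right)
    ultimately have "((\<lambda>k. ?M c k * ch k x y) has_sum
        ((ev (\<lambda>k. c (k + j)) x y + ev (\<lambda>k. c (k + - j)) x y) / 2)) UNIV"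
      by (simp only:)
    then have "ev (?M c) x y = (ev (\<lambda>k. c (k + j)) x y + ev (\<lambda>k. c (k + - j)) x y) / 2"
      unfolding ev_def[of "?M c"] by (rule infsumI)
    also have "\<dots> = (ev c x y * ch (- j) x y + ev c x y * ch j x y) / 2"
      by (simp only: ev_shift diff_minus_eq_add add_uminus_conv_diff)
    also have "\<dots> = of_real (cos (kx j * x + ky j * y)) * ev c x y"
    proof -
      have "ch j x y + cnj (ch j x y) = of_real (2 * cos (kx j * x + ky j * y))"
        by (simp only: complex_add_cnj) (simp add: ch_def)
      then show ?thesis
        by (simp add: ch_minus flip: distrib_left) (simp add: add.commute)
    qed
    finally show "R (?M c) x y = cos (kx j * x + ky j * y) * R c x y"
      by (simp add: R_def)
  next
    fix c :: "nat \<Rightarrow> int \<times> int \<Rightarrow> complex" and c' k assume "\<forall>k. (\<lambda>n. c n k) \<longlonglongrightarrow> c' k"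
    then show "(\<lambda>n. ?M (c n) k) \<longlonglongrightarrow> ?M c' k" by (intro tendsto_intros) auto
  qed (auto simp: algebra_simps)
  then show ?thesis unfolding trig_def by blast
qed

text \<open>Applying the multiplier to the coefficients of the constant 1 recovers \<open>b\<close>
  itself as a rapidly convergent Fourier series.\<close>

lemma trig_regular:
  assumes "trig b"
  shows "C2_plane b" "periodic2 L1 L2 b"
proof -
  obtain M where M: "multiplier M b" using assms by (auto simp: trig_def)
  let ?e = "\<lambda>k :: int \<times> int. if k = 0 then 1 else 0 :: complex"
  have "ev ?e x y = (\<Sum>\<^sub>\<infinity>k\<in>{0}. ?e k * ch k x y)" for x y
    unfolding ev_def by (rule infsum_cong_neutral) auto
  then have "R ?e x y = 1" for x y by (simp add: R_def)
  moreover have e: "decay p 1 ?e" for p by (auto simp: decay_def W_def)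
  then have "R (M ?e) x y = b x y * R ?e x y" for x y by (rule multiplier_R[OF M])
  ultimately have b: "b = R (M ?e)" by (simp add: fun_eq_iff)
  obtain C where "decay 3 (C * 1) (M ?e)" using multiplier_decay[OF M, of 3] e by blast
  then show "C2_plane b" unfolding b by (rule R_C2_plane(1))
  show "periodic2 L1 L2 b" unfolding b by (rule periodic2_R)
qed

end

section \<open>Functions of small energy that are large at the origin\<close>

lemma integral_sum_square:
  fixes f :: "nat \<Rightarrow> real \<Rightarrow> real"
  assumes "finite A" and "\<And>i. continuous_on {0..L} (f i)"
    and orth: "\<And>i j. i \<in> A \<Longrightarrow> j \<in> A \<Longrightarrow> integral {0..L} (\<lambda>t. f i t * f j t) = (if i = j then c else 0)"
  shows "integral {0..L} (\<lambda>t. (\<Sum>i\<in>A. a i * f i t)\<^sup>2) = c * (\<Sum>i\<in>A. (a i)\<^sup>2)"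
proof -
  have int: "(\<lambda>t. f i t * f j t) integrable_on {0..L}" for i j
    by (intro integrable_continuous_interval continuous_intros assms)
  have "integral {0..L} (\<lambda>t. (\<Sum>i\<in>A. a i * f i t)\<^sup>2) =
      integral {0..L} (\<lambda>t. \<Sum>i\<in>A. \<Sum>j\<in>A. a i * a j * (f i t * f j t))"
    by (simp add: power2_eq_square sum_product mult_ac)
  also have "\<dots> = (\<Sum>i\<in>A. \<Sum>j\<in>A. a i * a j * integral {0..L} (\<lambda>t. f i t * f j t))"
    using \<open>finite A\<close> int
    by (simp add: Henstock_Kurzweil_Integration.integral_sum integrable_sum integrable_on_mult_right)
  also have "\<dots> = (\<Sum>i\<in>A. \<Sum>j\<in>A. if i = j then c * (a i)\<^sup>2 else 0)"
    by (intro sum.cong refl) (auto simp: orth power2_eq_square)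
  also have "\<dots> = c * (\<Sum>i\<in>A. (a i)\<^sup>2)"
    using \<open>finite A\<close> by (simp add: sum_distrib_left)
  finally show ?thesis .
qed

lemma integral_cos_period:
  fixes m :: int
  assumes "L > 0"
  shows "integral {0..L} (\<lambda>t. cos (2 * pi / L * of_int m * t)) = (if m = 0 then L else 0)"
proof -
  have "(\<lambda>t. cis (2 * pi / L * of_int m * t)) integrable_on {0..L}"
    by (intro integrable_continuous_interval continuous_intros)
  from integral_linear[OF this bounded_linear_Re]
  show ?thesis
    using torus.integral_cis_period[of L L L m] assms by (auto simp: o_def torus_def split: if_splits)
qed

lemma trig_orthogonal:
  fixes i j :: nat
  assumes "L > 0" "i \<ge> 1" "j \<ge> 1"
  shows "integral {0..L} (\<lambda>t. cos (2 * pi / L * i * t) * cos (2 * pi / L * j * t)) = (if i = j then L / 2 else 0)"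
    and "integral {0..L} (\<lambda>t. sin (2 * pi / L * i * t) * sin (2 * pi / L * j * t)) = (if i = j then L / 2 else 0)"
proof -
  have int: "(\<lambda>t. cos (2 * pi / L * of_int m * t)) integrable_on {0..L}" for m
    by (intro integrable_continuous_interval continuous_intros)
  define m n where "m = int i - int j" and "n = int i + int j"
  \<comment> \<open>Positive indices keep the sum frequency nonzero, so only the difference
    frequency can contribute.\<close>
  have "n \<noteq> 0" "m = 0 \<longleftrightarrow> i = j" using assms by (auto simp: m_def n_def)
  have e: "2 * pi / L * i * t - 2 * pi / L * j * t = 2 * pi / L * of_int m * t"
    "2 * pi / L * i * t + 2 * pi / L * j * t = 2 * pi / L * of_int n * t" for t
    by (simp_all only: m_def n_def of_int_diff of_int_add of_int_of_nat_eq left_diff_distrib right_diff_distrib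
        distrib_left distrib_right)
  show "integral {0..L} (\<lambda>t. cos (2 * pi / L * i * t) * cos (2 * pi / L * j * t)) = (if i = j then L / 2 else 0)"
    unfolding cos_times_cos e integral_divide
    using \<open>n \<noteq> 0\<close> \<open>m = 0 \<longleftrightarrow> i = j\<close> integral_cos_period[OF assms(1)]
    by (simp only: Henstock_Kurzweil_Integration.integral_add[OF int int]) simp
  show "integral {0..L} (\<lambda>t. sin (2 * pi / L * i * t) * sin (2 * pi / L * j * t)) = (if i = j then L / 2 else 0)"
    unfolding sin_times_sin e integral_divide
    using \<open>n \<noteq> 0\<close> \<open>m = 0 \<longleftrightarrow> i = j\<close> integral_cos_period[OF assms(1)]
    by (simp only: Henstock_Kurzweil_Integration.integral_diff[OF int int]) simp
qed

text \<open>For fixed \<open>i\<close>, the \<open>i\<close> terms with \<open>j\<close> at most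
  \<open>i\<close> are each at least \<open>1 / (2 * (real i)\<^sup>2)\<close>; together they give
  half of a harmonic term.\<close>

lemma inverse_sum_squares_diverges:
  "\<exists>N. K \<le> (\<Sum>i\<in>{1..N}. \<Sum>j\<in>{1..N}. 1 / ((real i)\<^sup>2 + (real j)\<^sup>2))"
proof -
  have ge: "harm N / 2 \<le> (\<Sum>i\<in>{1..N}. \<Sum>j\<in>{1..N}. 1 / ((real i)\<^sup>2 + (real j)\<^sup>2))" for N
  proof -
    have "harm N / 2 = (\<Sum>i\<in>{1..N}. \<Sum>j\<in>{1..i}. 1 / (2 * (real i)\<^sup>2))"
      unfolding harm_def sum_divide_distrib by (intro sum.cong refl) (simp add: field_simps power2_eq_square)
    also have "\<dots> \<le> (\<Sum>i\<in>{1..N}. \<Sum>j\<in>{1..i}. 1 / ((real i)\<^sup>2 + (real j)\<^sup>2))"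
    proof (intro sum_mono divide_left_mono)
      fix i j assume "i \<in> {1..N}" "j \<in> {1..i}"
      then have "(real j)\<^sup>2 \<le> (real i)\<^sup>2" "(real i)\<^sup>2 > 0" by (auto intro!: power_mono)
      then show "(real i)\<^sup>2 + (real j)\<^sup>2 \<le> 2 * (real i)\<^sup>2" "0 < 2 * (real i)\<^sup>2 * ((real i)\<^sup>2 + (real j)\<^sup>2)"
        by (auto intro!: mult_pos_pos add_pos_nonneg)
    qed simp
    also have "\<dots> \<le> (\<Sum>i\<in>{1..N}. \<Sum>j\<in>{1..N}. 1 / ((real i)\<^sup>2 + (real j)\<^sup>2))"
      by (intro sum_mono sum_mono2) auto
    finally show ?thesis .
  qed
  have "\<forall>\<^sub>F N in sequentially. 2 * K \<le> (harm N :: real)"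
    using harm_at_top by (simp add: filterlim_at_top)
  then obtain N where "2 * K \<le> harm N"
    by (auto simp: eventually_sequentially)
  with ge[of N] show ?thesis by (intro exI[of _ N]) simp
qed

context torus
begin

lemma integral_double_sum_square:
  fixes f g :: "nat \<Rightarrow> real \<Rightarrow> real"
  assumes A: "finite A" and f: "\<And>i. continuous_on UNIV (f i)" and g: "\<And>i. continuous_on UNIV (g i)"
    and of: "\<And>i j. i \<in> A \<Longrightarrow> j \<in> A \<Longrightarrow> integral {0..L1} (\<lambda>t. f i t * f j t) = (if i = j then L1 / 2 else 0)"
    and og: "\<And>i j. i \<in> A \<Longrightarrow> j \<in> A \<Longrightarrow> integral {0..L2} (\<lambda>t. g i t * g j t) = (if i = j then L2 / 2 else 0)"
  shows "integral box (\<lambda>p. (\<Sum>i\<in>A. \<Sum>j\<in>A. a i j * f i (fst p) * g j (snd p))\<^sup>2) =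
    L1 * L2 / 4 * (\<Sum>i\<in>A. \<Sum>j\<in>A. (a i j)\<^sup>2)"
proof -
  note f' = continuous_on_subset[OF f subset_UNIV] and g' = continuous_on_subset[OF g subset_UNIV]
  have cf: "continuous_on S (\<lambda>p. f i (fst p))" and cg: "continuous_on S (\<lambda>p. g i (snd p))" for i and S :: "(real \<times> real) set"
    using continuous_on_compose2[OF f continuous_on_fst[OF continuous_on_id]]
      continuous_on_compose2[OF g continuous_on_snd[OF continuous_on_id]] by auto
  have "integral box (\<lambda>p. (\<Sum>i\<in>A. \<Sum>j\<in>A. a i j * f i (fst p) * g j (snd p))\<^sup>2) =
      integral {0..L1} (\<lambda>x. integral {0..L2} (\<lambda>y. (\<Sum>i\<in>A. \<Sum>j\<in>A. a i j * f i x * g j y)\<^sup>2))"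
    by (subst integral_prod_continuous) (auto intro!: continuous_intros cf cg)
  also have "\<dots> = integral {0..L1} (\<lambda>x. integral {0..L2} (\<lambda>y. (\<Sum>j\<in>A. (\<Sum>i\<in>A. a i j * f i x) * g j y)\<^sup>2))"
    by (subst sum.swap) (simp add: sum_distrib_right)
  also have "\<dots> = integral {0..L1} (\<lambda>x. L2 / 2 * (\<Sum>j\<in>A. (\<Sum>i\<in>A. a i j * f i x)\<^sup>2))"
    by (simp only: integral_sum_square[OF A g' og])
  also have "\<dots> = L2 / 2 * (\<Sum>j\<in>A. integral {0..L1} (\<lambda>x. (\<Sum>i\<in>A. a i j * f i x)\<^sup>2))"
    by (subst integral_mult_right, subst Henstock_Kurzweil_Integration.integral_sum)
      (auto intro!: A integrable_continuous_interval continuous_intros f')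
  also have "\<dots> = L2 / 2 * (\<Sum>j\<in>A. L1 / 2 * (\<Sum>i\<in>A. (a i j)\<^sup>2))"
    by (simp only: integral_sum_square[OF A f' of])
  also have "\<dots> = L1 * L2 / 4 * (\<Sum>j\<in>A. \<Sum>i\<in>A. (a i j)\<^sup>2)"
    by (simp add: sum_distrib_left mult_ac)
  also have "(\<Sum>j\<in>A. \<Sum>i\<in>A. (a i j)\<^sup>2) = (\<Sum>i\<in>A. \<Sum>j\<in>A. (a i j)\<^sup>2)"
    by (rule sum.swap)
  finally show ?thesis .
qed

lemma cos_sin_period:
  fixes i :: nat
  assumes "L > 0"
  shows "cos (2 * pi / L * i * (t + L)) = cos (2 * pi / L * i * t)"
proof -
  have "2 * pi / L * i * (t + L) = 2 * pi / L * i * t + 2 * pi * of_int (int i)"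
    using assms by (simp add: distrib_left)
  then show ?thesis
    by (simp only: cos_add cos_int_2pin sin_int_2pin mult_1_right mult_zero_right diff_zero)
qed

text \<open>Partial sums of the Fourier series of the Green function: points have zero capacity in the plane.\<close>

lemma capacity_function:
  defines "\<Omega> \<equiv> (2 * pi / L1)\<^sup>2 + (2 * pi / L2)\<^sup>2"
  obtains \<phi> \<phi>x \<phi>y :: "real \<Rightarrow> real \<Rightarrow> real" where
    "\<And>x y. ((\<lambda>s. \<phi> s y) has_real_derivative \<phi>x x y) (at x)"
    "\<And>x y. ((\<lambda>t. \<phi> x t) has_real_derivative \<phi>y x y) (at y)"
    "cont2 \<phi>" "cont2 \<phi>x" "cont2 \<phi>y" "periodic2 L1 L2 \<phi>" "\<phi> 0 0 \<ge> K"
    "integral box (\<lambda>p. (\<phi> (fst p) (snd p))\<^sup>2) \<le> L1 * L2 / 4 * \<phi> 0 0"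
    "integral box (\<lambda>p. (\<phi>x (fst p) (snd p))\<^sup>2) + integral box (\<lambda>p. (\<phi>y (fst p) (snd p))\<^sup>2)
      \<le> L1 * L2 / 4 * (\<Omega> * \<phi> 0 0)"
proof -
  obtain N where N: "K \<le> (\<Sum>i\<in>{1..N}. \<Sum>j\<in>{1..N}. 1 / ((real i)\<^sup>2 + (real j)\<^sup>2))"
    using inverse_sum_squares_diverges by blast
  define A where "A = {1..N}"
  \<comment> \<open>Up to constants these are Green's function coefficients. Since
    \<open>a i j\<close> is at most 1 and
    \<open>a i j * ((real i)\<^sup>2 + (real j)\<^sup>2) = 1\<close>, both the mass and the energy
    are bounded by the plain sum of the \<open>a i j\<close>, which is the value at the origin and
    diverges with \<open>N\<close>.\<close>
  define a where "a i j = 1 / ((real i)\<^sup>2 + (real j)\<^sup>2)" for i j :: nat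
  define v1 where "v1 i = 2 * pi / L1 * real i" for i
  define v2 where "v2 j = 2 * pi / L2 * real j" for j
  define \<phi> where "\<phi> x y = (\<Sum>i\<in>A. \<Sum>j\<in>A. a i j * cos (v1 i * x) * cos (v2 j * y))" for x y
  define \<phi>x where "\<phi>x x y = (\<Sum>i\<in>A. \<Sum>j\<in>A. (- v1 i * a i j) * sin (v1 i * x) * cos (v2 j * y))" for x y
  define \<phi>y where "\<phi>y x y = (\<Sum>i\<in>A. \<Sum>j\<in>A. (- v2 j * a i j) * cos (v1 i * x) * sin (v2 j * y))" for x y
  define \<sigma> where "\<sigma> = (\<Sum>i\<in>A. \<Sum>j\<in>A. a i j)"
  have \<phi>0: "\<phi> 0 0 = \<sigma>" by (simp add: \<phi>_def \<sigma>_def)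
  have A: "finite A" by (simp add: A_def)
  have orth: "i \<in> A \<Longrightarrow> j \<in> A \<Longrightarrow> integral {0..L1} (\<lambda>t. cos (v1 i * t) * cos (v1 j * t)) = (if i = j then L1 / 2 else 0)"
    "i \<in> A \<Longrightarrow> j \<in> A \<Longrightarrow> integral {0..L1} (\<lambda>t. sin (v1 i * t) * sin (v1 j * t)) = (if i = j then L1 / 2 else 0)"
    "i \<in> A \<Longrightarrow> j \<in> A \<Longrightarrow> integral {0..L2} (\<lambda>t. cos (v2 i * t) * cos (v2 j * t)) = (if i = j then L2 / 2 else 0)"
    "i \<in> A \<Longrightarrow> j \<in> A \<Longrightarrow> integral {0..L2} (\<lambda>t. sin (v2 i * t) * sin (v2 j * t)) = (if i = j then L2 / 2 else 0)" for i j
    unfolding v1_def v2_def A_def using trig_orthogonal L1 L2 by simp_all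
  have cont: "continuous_on UNIV (\<lambda>t. cos (v * t))" "continuous_on UNIV (\<lambda>t. sin (v * t))" for v :: real
    by (intro continuous_intros)+
  have a_bounds: "0 \<le> a i j" "(a i j)\<^sup>2 \<le> a i j" "(v1 i * a i j)\<^sup>2 + (v2 j * a i j)\<^sup>2 \<le> \<Omega> * a i j"
    if "i \<in> A" for i j
  proof -
    have r: "(real i)\<^sup>2 \<ge> 1" using that by (simp add: A_def one_le_power)
    then have pos: "(real i)\<^sup>2 + (real j)\<^sup>2 \<ge> 1" by (simp add: add_increasing2)
    show a0: "0 \<le> a i j" by (simp add: a_def)
    have "a i j \<le> 1" using pos by (simp add: a_def divide_le_eq)
    then show "(a i j)\<^sup>2 \<le> a i j" using a0 by (simp add: power2_eq_square mult_left_le)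
    have one: "a i j * (a i j * ((real i)\<^sup>2 + (real j)\<^sup>2)) = a i j"
      using pos by (simp add: a_def)
    have "(v1 i * a i j)\<^sup>2 + (v2 j * a i j)\<^sup>2 = (2 * pi / L1)\<^sup>2 * (real i)\<^sup>2 * (a i j)\<^sup>2 + (2 * pi / L2)\<^sup>2 * (real j)\<^sup>2 * (a i j)\<^sup>2"
      by (simp add: v1_def v2_def power_mult_distrib power_divide)
    also have "\<dots> \<le> \<Omega> * (real i)\<^sup>2 * (a i j)\<^sup>2 + \<Omega> * (real j)\<^sup>2 * (a i j)\<^sup>2"
      unfolding \<Omega>_def by (intro add_mono mult_right_mono) auto
    also have "\<dots> = \<Omega> * (a i j * (a i j * ((real i)\<^sup>2 + (real j)\<^sup>2)))"
      by (simp add: power2_eq_square algebra_simps)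
    finally show "(v1 i * a i j)\<^sup>2 + (v2 j * a i j)\<^sup>2 \<le> \<Omega> * a i j"
      unfolding one .
  qed
  show thesis
  proof
    show "((\<lambda>s. \<phi> s y) has_real_derivative \<phi>x x y) (at x)" for x y
      unfolding \<phi>_def \<phi>x_def by (auto intro!: derivative_eq_intros sum.cong)
    show "((\<lambda>t. \<phi> x t) has_real_derivative \<phi>y x y) (at y)" for x y
      unfolding \<phi>_def \<phi>y_def by (auto intro!: derivative_eq_intros sum.cong)
    show "cont2 \<phi>" "cont2 \<phi>x" "cont2 \<phi>y"
      unfolding \<phi>_def \<phi>x_def \<phi>y_def cont2_def by (intro continuous_intros)+
    show "periodic2 L1 L2 \<phi>"
      unfolding periodic2_def \<phi>_def v1_def v2_def by (simp only: cos_sin_period[OF L1] cos_sin_period[OF L2]) simp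
    show "\<phi> 0 0 \<ge> K" using N unfolding \<phi>0 \<sigma>_def A_def a_def .
    have A0: "L1 * L2 / 4 \<ge> 0" using L1 L2 by simp
    have "integral box (\<lambda>p. (\<phi> (fst p) (snd p))\<^sup>2) = L1 * L2 / 4 * (\<Sum>i\<in>A. \<Sum>j\<in>A. (a i j)\<^sup>2)"
      unfolding \<phi>_def by (rule integral_double_sum_square[OF A cont(1) cont(1) orth(1) orth(3)])
    also have "\<dots> \<le> L1 * L2 / 4 * \<sigma>"
      unfolding \<sigma>_def by (intro mult_left_mono[OF _ A0] sum_mono a_bounds)
    finally show "integral box (\<lambda>p. (\<phi> (fst p) (snd p))\<^sup>2) \<le> L1 * L2 / 4 * \<phi> 0 0"
      unfolding \<phi>0 .
    have "integral box (\<lambda>p. (\<phi>x (fst p) (snd p))\<^sup>2) = L1 * L2 / 4 * (\<Sum>i\<in>A. \<Sum>j\<in>A. (- v1 i * a i j)\<^sup>2)"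
      unfolding \<phi>x_def by (rule integral_double_sum_square[OF A cont(2) cont(1) orth(2) orth(3)])
    moreover have "integral box (\<lambda>p. (\<phi>y (fst p) (snd p))\<^sup>2) = L1 * L2 / 4 * (\<Sum>i\<in>A. \<Sum>j\<in>A. (- v2 j * a i j)\<^sup>2)"
      unfolding \<phi>y_def by (rule integral_double_sum_square[OF A cont(1) cont(2) orth(1) orth(4)])
    ultimately have "integral box (\<lambda>p. (\<phi>x (fst p) (snd p))\<^sup>2) + integral box (\<lambda>p. (\<phi>y (fst p) (snd p))\<^sup>2)
      = L1 * L2 / 4 * (\<Sum>i\<in>A. \<Sum>j\<in>A. (v1 i * a i j)\<^sup>2 + (v2 j * a i j)\<^sup>2)"
      by (simp add: sum.distrib distrib_left)
    also have "\<dots> \<le> L1 * L2 / 4 * (\<Sum>i\<in>A. \<Sum>j\<in>A. \<Omega> * a i j)"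
      by (intro mult_left_mono[OF _ A0] sum_mono a_bounds)
    finally show "integral box (\<lambda>p. (\<phi>x (fst p) (snd p))\<^sup>2) + integral box (\<lambda>p. (\<phi>y (fst p) (snd p))\<^sup>2)
      \<le> L1 * L2 / 4 * (\<Omega> * \<phi> 0 0)"
      unfolding \<phi>0 \<sigma>_def by (simp add: sum_distrib_left)
  qed
qed

section \<open>Concentrating growth rates\<close>

text \<open>A trigonometric polynomial with values between 0 and 1 that reaches 1 only at the
  lattice points, so its powers stay nonnegative and concentrate there.\<close>

definition peak :: "real \<Rightarrow> real \<Rightarrow> real" where
  "peak x y = (2 + cos (2 * pi / L1 * x) + cos (2 * pi / L2 * y)) / 4"

lemma peak_bounds: "0 \<le> peak x y" "peak x y \<le> 1"
proof -
  have "0 \<le> (2 + u + v) / 4 \<and> (2 + u + v) / 4 \<le> 1" if "\<bar>u\<bar> \<le> 1" "\<bar>v\<bar> \<le> 1" for u v :: real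
    using that by (simp add: abs_le_iff)
  from this[OF abs_cos_le_one abs_cos_le_one]
  show "0 \<le> peak x y" "peak x y \<le> 1" unfolding peak_def by blast+
qed

lemma peak_eq_1:
  assumes "peak x y = 1" "0 \<le> x" "x \<le> L1" "0 \<le> y" "y \<le> L2"
  shows "(x = 0 \<or> x = L1) \<and> (y = 0 \<or> y = L2)"
proof -
  have *: "t = 0 \<or> t = L" if L: "L > 0" and t: "0 \<le> t" "t \<le> L" and "cos (2 * pi / L * t) = 1" for t L :: real
  proof -
    obtain n :: int where "2 * pi / L * t = of_int n * 2 * pi"
      using \<open>cos (2 * pi / L * t) = 1\<close> cos_one_2pi_int by blast
    then have tn: "t = of_int n * L" using L by (simp add: field_simps)
    then have "0 \<le> n" "n \<le> 1" using t L by (auto simp: zero_le_mult_iff)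
    then have "n = 0 \<or> n = 1" by linarith
    then show ?thesis using tn by auto
  qed
  have "u = 1 \<and> v = 1" if "u \<le> 1" "v \<le> 1" "(2 + u + v) / 4 = 1" for u v :: real
    using that by auto
  from this[OF cos_le_one cos_le_one assms(1)[unfolded peak_def]]
  have "cos (2 * pi / L1 * x) = 1" "cos (2 * pi / L2 * y) = 1" by blast+
  then show ?thesis using *[OF L1] *[OF L2] assms by blast
qed

lemma trig_peak: "trig peak"
proof -
  have "trig (\<lambda>x y. (1 / 4) * (2 * 1 + (cos (kx (1, 0) * x + ky (1, 0) * y) + cos (kx (0, 1) * x + ky (0, 1) * y))))"
    by (intro trig_scale trig_add trig_1 trig_cos)
  then show ?thesis
    by (simp add: peak_def[abs_def] kx_def ky_def add.assoc)
qed

lemma cont2_peak: "cont2 peak"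
  using trig_regular(1)[OF trig_peak] by (simp add: C2_plane_def C1_plane_def)

lemma cont2_power: "cont2 f \<Longrightarrow> cont2 (\<lambda>x y. f x y ^ n)"
  unfolding cont2_def by (intro continuous_intros)

lemma cont2_mult: "cont2 f \<Longrightarrow> cont2 g \<Longrightarrow> cont2 (\<lambda>x y. f x y * g x y)"
  unfolding cont2_def by (intro continuous_intros)

text \<open>By continuity \<open>peak\<close> is at least \<open>\<rho>\<close> on a small square at
  the corner of the box, whose area is \<kappa>. The integrals thus decay more slowly than any
  geometric sequence with ratio below 1.\<close>

lemma peak_power_integral_ge:
  assumes "0 \<le> \<rho>" "\<rho> < 1"
  obtains \<kappa> where "\<kappa> > 0" "\<And>n. \<kappa> * \<rho> ^ n \<le> integral box (\<lambda>p. peak (fst p) (snd p) ^ n)"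
proof -
  have cont: "continuous_on UNIV (\<lambda>p. peak (fst p) (snd p))"
    using cont2_peak by (simp add: cont2_def)
  have "peak 0 0 = 1" by (simp add: peak_def)
  with cont[unfolded continuous_on_iff, rule_format, of "(0, 0)" "1 - \<rho>"] assms(2)
  obtain e where "e > 0" and e: "\<And>p. dist p (0, 0) < e \<Longrightarrow> dist (peak (fst p) (snd p)) 1 < 1 - \<rho>"
    by auto
  define \<eta> where "\<eta> = min (min L1 L2) (e / 3)"
  have \<eta>: "0 < \<eta>" "\<eta> \<le> L1" "\<eta> \<le> L2" "\<eta> < e / 2"
    using L1 L2 \<open>e > 0\<close> by (auto simp: \<eta>_def)
  have ge: "\<rho> \<le> peak x y" if "0 \<le> x" "x \<le> \<eta>" "0 \<le> y" "y \<le> \<eta>" for x y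
  proof -
    have "dist (x, y) (0, 0) \<le> \<bar>x\<bar> + \<bar>y\<bar>"
      by (simp add: dist_prod_def dist_real_def sqrt_sum_squares_le_sum_abs)
    also have "\<dots> < e" using that \<eta> by simp
    finally show ?thesis using e[of "(x, y)"] by (simp add: dist_real_def abs_if split: if_splits)
  qed
  have "\<eta>\<^sup>2 * \<rho> ^ n \<le> integral box (\<lambda>p. peak (fst p) (snd p) ^ n)" for n
  proof -
    let ?S = "cbox (0, 0) (\<eta>, \<eta>)"
    have sub: "?S \<subseteq> box" using \<eta> by (auto simp: cbox_Pair_eq)
    have int: "(\<lambda>p. peak (fst p) (snd p) ^ n) integrable_on cbox u v" for u v
      using cont2_power[OF cont2_peak, of n] unfolding cont2_def
      by (intro integrable_continuous) (rule continuous_on_subset, auto)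
    have "\<eta>\<^sup>2 * \<rho> ^ n = integral ?S (\<lambda>p. \<rho> ^ n)"
      using \<eta> by (simp add: content_Pair power2_eq_square)
    also have "\<dots> \<le> integral ?S (\<lambda>p. peak (fst p) (snd p) ^ n)"
      by (intro integral_le integrable_const int) (auto simp: cbox_Pair_eq intro!: power_mono ge assms)
    also have "\<dots> \<le> integral box (\<lambda>p. peak (fst p) (snd p) ^ n)"
      by (intro integral_subset_le[OF sub] int) (auto intro!: zero_le_power peak_bounds)
    finally show ?thesis .
  qed
  then show thesis using \<eta> by (intro that[of "\<eta>\<^sup>2"]) auto
qed

text \<open>Away from the lattice points \<open>peak\<close> stays below some
  \<open>\<rho> < 1\<close>, so that region contributes at most \<open>\<rho> ^ n\<close> times the
  area, negligible against the whole integral. Elsewhere \<open>g\<close> is close to its value at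
  the origin.\<close>

lemma peak_concentrates:
  assumes g: "cont2 g" "periodic2 L1 L2 g" "\<And>x y. g x y \<ge> 0" and pos: "g 0 0 > 0"
  obtains n where "g 0 0 / 2 * integral box (\<lambda>p. peak (fst p) (snd p) ^ n) \<le>
    integral box (\<lambda>p. peak (fst p) (snd p) ^ n * g (fst p) (snd p))"
proof -
  \<comment> \<open>Chosen so that losing a third of the mass still leaves one half:
    \<open>3 / 4 * (2 / 3) = 1 / 2\<close>.\<close>
  define h where "h = 3 / 4 * g 0 0"
  have h: "0 < h" "h < g 0 0" using pos by (auto simp: h_def)
  obtain \<rho> where \<rho>: "0 \<le> \<rho>" "\<rho> < 1"
    and dich: "\<And>p. p \<in> box \<Longrightarrow> h \<le> g (fst p) (snd p) \<or> peak (fst p) (snd p) \<le> \<rho>"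
  proof -
    define Z where "Z = {p \<in> box. g (fst p) (snd p) \<le> h}"
    have cg: "continuous_on box (\<lambda>p. g (fst p) (snd p))"
      using g(1) continuous_on_subset unfolding cont2_def by blast
    have "closed Z"
      unfolding Z_def by (rule continuous_on_closed_Collect_le[OF cg continuous_on_const closed_cbox])
    moreover have "Z \<subseteq> box" by (auto simp: Z_def)
    ultimately have "compact Z"
      using compact_cbox closed_Int_compact by (metis inf.absorb_iff1)
    show thesis
    proof (cases "Z = {}")
      case True
      then show thesis by (intro that[of 0]) (auto simp: Z_def not_le less_imp_le)
    next
      case False
      have "continuous_on Z (\<lambda>p. peak (fst p) (snd p))"
        using cont2_peak continuous_on_subset unfolding cont2_def by blast
      with \<open>compact Z\<close> False have "\<exists>z\<in>Z. \<forall>p\<in>Z. peak (fst p) (snd p) \<le> peak (fst z) (snd z)"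
        by (rule continuous_attains_sup)
      then obtain z where z: "z \<in> Z" "\<And>p. p \<in> Z \<Longrightarrow> peak (fst p) (snd p) \<le> peak (fst z) (snd z)"
        by blast
      obtain x y where zxy: "z = (x, y)" by (cases z)
      \<comment> \<open>Within the box, \<open>peak\<close> equals 1 only at the four corners; there
        \<open>g\<close> takes its value at the origin by periodicity and exceeds \<open>h\<close>,
        so \<open>Z\<close> avoids them.\<close>
      have "peak x y \<noteq> 1"
      proof
        assume "peak x y = 1"
        then have "(x = 0 \<or> x = L1) \<and> (y = 0 \<or> y = L2)"
          using z(1) zxy by (intro peak_eq_1) (auto simp: Z_def cbox_Pair_eq)
        moreover have "g L1 0 = g 0 0" "g 0 L2 = g 0 0" "g L1 L2 = g L1 0"
          using g(2)[unfolded periodic2_def, rule_format, of 0 0]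
            g(2)[unfolded periodic2_def, rule_format, of L1 0] by simp_all
        ultimately have "g x y = g 0 0" by auto
        then show False using z(1) zxy h by (simp add: Z_def)
      qed
      then have "peak x y < 1" using peak_bounds(2)[of x y] by simp
      moreover have "h \<le> g (fst p) (snd p) \<or> peak (fst p) (snd p) \<le> peak x y" if "p \<in> box" for p
        using z(2)[of p] zxy that unfolding Z_def by (cases "g (fst p) (snd p) \<le> h") simp_all
      ultimately show thesis
        using peak_bounds(1)[of x y] by (intro that[of "peak x y"])
    qed
  qed
  \<comment> \<open>A ratio strictly between \<open>\<rho>\<close> and 1: the total integral is at
    least of order \<open>\<rho>' ^ n\<close>, so \<open>\<rho> ^ n\<close> becomes relatively
    small.\<close>
  define \<rho>' where "\<rho>' = (1 + \<rho>) / 2"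
  have \<rho>': "0 < \<rho>'" "\<rho>' < 1" "\<rho> < \<rho>'" using \<rho> by (auto simp: \<rho>'_def)
  obtain \<kappa> where \<kappa>: "\<kappa> > 0" "\<And>n. \<kappa> * \<rho>' ^ n \<le> integral box (\<lambda>p. peak (fst p) (snd p) ^ n)"
    using peak_power_integral_ge[OF less_imp_le[OF \<rho>'(1)] \<rho>'(2)] by blast
  define A where "A = L1 * L2"
  have "A > 0" using L1 L2 by (simp add: A_def)
  obtain n where n: "(\<rho> / \<rho>') ^ n < \<kappa> / (3 * A)"
    using real_arch_pow_inv[of "\<kappa> / (3 * A)" "\<rho> / \<rho>'"] \<kappa>(1) \<open>A > 0\<close> \<rho>' by auto
  define I where "I = integral box (\<lambda>p. peak (fst p) (snd p) ^ n)"
  have "\<rho> ^ n * (3 * A) \<le> \<kappa> * \<rho>' ^ n"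
    using n \<rho>'(1) \<open>A > 0\<close> by (simp add: power_divide field_simps)
  with \<kappa>(2)[of n] have I: "\<rho> ^ n * A \<le> I / 3" by (simp add: I_def)
  have int: "(\<lambda>p. peak (fst p) (snd p) ^ n) integrable_on box"
    "(\<lambda>p. peak (fst p) (snd p) ^ n * g (fst p) (snd p)) integrable_on box"
    using cont2_integrable[OF cont2_power[OF cont2_peak, of n]]
      cont2_integrable[OF cont2_mult[OF cont2_power[OF cont2_peak, of n] g(1)]] by simp_all
  have "integral box (\<lambda>p. h * (peak (fst p) (snd p) ^ n - \<rho> ^ n)) \<le>
      integral box (\<lambda>p. peak (fst p) (snd p) ^ n * g (fst p) (snd p))"
  proof (rule integral_le)
    show "(\<lambda>p. h * (peak (fst p) (snd p) ^ n - \<rho> ^ n)) integrable_on box"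
      by (intro integrable_on_mult_right integrable_diff int integrable_const)
    fix p assume "p \<in> box"
    have pk: "peak (fst p) (snd p) ^ n \<ge> 0" using peak_bounds(1) by simp
    from dich[OF \<open>p \<in> box\<close>] show "h * (peak (fst p) (snd p) ^ n - \<rho> ^ n) \<le> peak (fst p) (snd p) ^ n * g (fst p) (snd p)"
    proof
      assume "h \<le> g (fst p) (snd p)"
      then have "peak (fst p) (snd p) ^ n * h \<le> peak (fst p) (snd p) ^ n * g (fst p) (snd p)"
        using pk by (rule mult_left_mono)
      moreover have "h * \<rho> ^ n \<ge> 0" using h \<rho> by simp
      ultimately show ?thesis by (simp add: algebra_simps)
    next
      assume "peak (fst p) (snd p) \<le> \<rho>"
      then have "peak (fst p) (snd p) ^ n \<le> \<rho> ^ n" using peak_bounds(1) by (rule power_mono)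
      then have "h * (peak (fst p) (snd p) ^ n - \<rho> ^ n) \<le> 0" using h by (simp add: mult_le_0_iff)
      also have "0 \<le> peak (fst p) (snd p) ^ n * g (fst p) (snd p)" using pk g(3) by simp
      finally show ?thesis .
    qed
  qed (rule int)
  also have "integral box (\<lambda>p. h * (peak (fst p) (snd p) ^ n - \<rho> ^ n)) = h * (I - \<rho> ^ n * A)"
    using int L1 L2
    by (simp add: Henstock_Kurzweil_Integration.integral_diff integrable_const I_def content_Pair A_def)
  finally have "h * (I - \<rho> ^ n * A) \<le> integral box (\<lambda>p. peak (fst p) (snd p) ^ n * g (fst p) (snd p))" .
  moreover have "h * (2 / 3 * I) \<le> h * (I - \<rho> ^ n * A)"
    using I h by (intro mult_left_mono) auto
  moreover have "h * (2 / 3 * I) = g 0 0 / 2 * I" by (simp add: h_def)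
  ultimately have "g 0 0 / 2 * I \<le> integral box (\<lambda>p. peak (fst p) (snd p) ^ n * g (fst p) (snd p))"
    by linarith
  then show thesis unfolding I_def by (rule that)
qed

lemma exists_large_eigenvalue:
  assumes "\<alpha> > 0"
  obtains b where "b \<in> Lambda_xy L1 L2 \<alpha>" "trig b"
    "\<And>lam \<theta> \<mu>. is_principal_eig L1 L2 lam \<theta> b \<mu> \<Longrightarrow> m \<le> lam\<^sup>2 - \<mu>"
proof -
  define \<Omega> where "\<Omega> = (2 * pi / L1)\<^sup>2 + (2 * pi / L2)\<^sup>2"
  define A where "A = L1 * L2"
  have "A > 0" using L1 L2 by (simp add: A_def)
  \<comment> \<open>The estimate below ends in \<open>2 * \<alpha> * \<phi> 0 0 \<le> lam\<^sup>2 -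
    \<mu> + \<Omega>\<close>, which dictates the threshold for the value at the origin.\<close>
  obtain \<phi> \<phi>x \<phi>y where d: "\<And>x y. ((\<lambda>s. \<phi> s y) has_real_derivative \<phi>x x y) (at x)"
    "\<And>x y. ((\<lambda>t. \<phi> x t) has_real_derivative \<phi>y x y) (at y)"
    and c: "cont2 \<phi>" "cont2 \<phi>x" "cont2 \<phi>y" and per: "periodic2 L1 L2 \<phi>"
    and big: "\<phi> 0 0 \<ge> max 1 ((m + \<Omega>) / (2 * \<alpha>))"
    and mass: "integral box (\<lambda>p. (\<phi> (fst p) (snd p))\<^sup>2) \<le> A / 4 * \<phi> 0 0"
    and energy: "integral box (\<lambda>p. (\<phi>x (fst p) (snd p))\<^sup>2) + integral box (\<lambda>p. (\<phi>y (fst p) (snd p))\<^sup>2)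
      \<le> A / 4 * (\<Omega> * \<phi> 0 0)"
    by (rule capacity_function[of "max 1 ((m + \<Omega>) / (2 * \<alpha>))", folded \<Omega>_def A_def]) (rule that)
  define \<sigma> where "\<sigma> = \<phi> 0 0"
  have \<sigma>: "\<sigma> \<ge> 1" "m + \<Omega> \<le> 2 * \<alpha> * \<sigma>"
    using big assms by (auto simp: \<sigma>_def field_simps)
  have "cont2 (\<lambda>x y. (\<phi> x y)\<^sup>2)" using c(1) by (rule cont2_power)
  moreover have "periodic2 L1 L2 (\<lambda>x y. (\<phi> x y)\<^sup>2)" using per by (simp add: periodic2_def)
  moreover have "(\<phi> 0 0)\<^sup>2 > 0" using \<sigma> by (simp add: \<sigma>_def)
  ultimately obtain n where n: "\<sigma>\<^sup>2 / 2 * integral box (\<lambda>p. peak (fst p) (snd p) ^ n) \<le>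
      integral box (\<lambda>p. peak (fst p) (snd p) ^ n * (\<phi> (fst p) (snd p))\<^sup>2)"
    using peak_concentrates[of "\<lambda>x y. (\<phi> x y)\<^sup>2"] unfolding \<sigma>_def by auto
  define I where "I = integral box (\<lambda>p. peak (fst p) (snd p) ^ n)"
  obtain \<kappa> where "\<kappa> > 0" and \<kappa>: "\<And>n. \<kappa> * (1 / 2) ^ n \<le> integral box (\<lambda>p. peak (fst p) (snd p) ^ n)"
    by (rule peak_power_integral_ge[of "1 / 2"], simp, simp, rule that)
  have "0 < \<kappa> * (1 / 2) ^ n" using \<open>\<kappa> > 0\<close> by simp
  also have "\<dots> \<le> I" unfolding I_def by (rule \<kappa>)
  finally have "I > 0" .
  \<comment> \<open>Normalises the mean of \<open>b\<close> to \<alpha>; in the test integral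
    \<open>I\<close> cancels, so the size of \<open>n\<close> leaves no trace in the bound.\<close>
  define r where "r = \<alpha> * A / I"
  have "r > 0" using assms \<open>A > 0\<close> \<open>I > 0\<close> by (simp add: r_def)
  define b where "b x y = r * peak x y ^ n" for x y
  have tb: "trig b" unfolding b_def by (intro trig_scale trig_power trig_peak)
  have C1: "C1_plane b" using trig_regular(1)[OF tb] by (simp add: C2_plane_def)
  then have cb: "cont2 b" by (simp add: C1_plane_def)
  have nonneg: "b x y \<ge> 0" for x y
    using \<open>r > 0\<close> peak_bounds(1) by (simp add: b_def)
  have "integral box (\<lambda>p. b (fst p) (snd p)) = \<alpha> * L1 * L2"
    using \<open>I > 0\<close> by (simp add: b_def I_def[symmetric] r_def A_def)
  then have "b \<in> Lambda_xy L1 L2 \<alpha>"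
    unfolding Lambda_xy_def using C1 nonneg trig_regular(2)[OF tb] by simp
  moreover have "m \<le> lam\<^sup>2 - \<mu>" if eig: "is_principal_eig L1 L2 lam \<theta> b \<mu>" for lam \<theta> \<mu>
  proof -
    \<comment> \<open>The sign is what allows the mass of the test function to be replaced by its
      upper bound.\<close>
    have k: "lam\<^sup>2 - \<mu> \<ge> 0"
      using is_principal_eig_nonpos[OF L1 L2 nonneg eig] zero_le_power2[of lam] by linarith
    have "r * (\<sigma>\<^sup>2 / 2 * I) \<le> r * integral box (\<lambda>p. peak (fst p) (snd p) ^ n * (\<phi> (fst p) (snd p))\<^sup>2)"
      using n \<open>r > 0\<close> unfolding I_def by (intro mult_left_mono) auto
    also have "\<dots> = integral box (\<lambda>p. b (fst p) (snd p) * (\<phi> (fst p) (snd p))\<^sup>2)"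
      by (simp add: b_def mult.assoc)
    also have "\<dots> \<le> (lam\<^sup>2 - \<mu>) * integral box (\<lambda>p. (\<phi> (fst p) (snd p))\<^sup>2) +
        integral box (\<lambda>p. (\<phi>x (fst p) (snd p))\<^sup>2) + integral box (\<lambda>p. (\<phi>y (fst p) (snd p))\<^sup>2)"
      by (rule principal_eig_variational[OF eig cb d c per])
    also have "\<dots> \<le> (lam\<^sup>2 - \<mu>) * (A / 4 * \<sigma>) + A / 4 * (\<Omega> * \<sigma>)"
      using mult_left_mono[OF mass k] energy by (simp add: \<sigma>_def)
    also have "r * (\<sigma>\<^sup>2 / 2 * I) = A / 4 * \<sigma> * (2 * \<alpha> * \<sigma>)"
      using \<open>I > 0\<close> by (simp add: r_def power2_eq_square)
    also have "(lam\<^sup>2 - \<mu>) * (A / 4 * \<sigma>) + A / 4 * (\<Omega> * \<sigma>) = A / 4 * \<sigma> * (lam\<^sup>2 - \<mu> + \<Omega>)"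
      by algebra
    finally have "A / 4 * \<sigma> * (2 * \<alpha> * \<sigma>) \<le> A / 4 * \<sigma> * (lam\<^sup>2 - \<mu> + \<Omega>)" .
    moreover have "A / 4 * \<sigma> > 0" using \<open>A > 0\<close> \<sigma> by simp
    ultimately have "2 * \<alpha> * \<sigma> \<le> lam\<^sup>2 - \<mu> + \<Omega>"
      by (simp only: mult_le_cancel_left_pos)
    then show ?thesis using \<sigma> by linarith
  qed
  ultimately show thesis using that tb by blast
qed

lemma trig_exists_principal_eig:
  assumes "trig b" "\<And>x y. b x y \<ge> 0"
  shows "\<exists>\<mu>. is_principal_eig L1 L2 lam \<theta> b \<mu>"
proof -
  have "cont2 b" "periodic2 L1 L2 b"
    using trig_regular[OF assms(1)] by (auto simp: C2_plane_def C1_plane_def)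
  then have "cont2 (\<lambda>x y. - b x y)" "periodic2 L1 L2 (\<lambda>x y. - b x y)"
    unfolding cont2_def periodic2_def by (auto intro!: continuous_intros)
  then obtain x0 y0 where max: "\<And>x y. b x y \<le> b x0 y0"
    using periodic2_attains_min[OF L1 L2, of "\<lambda>x y. - b x y"] by auto
  obtain M where "multiplier M (\<lambda>x y. b x y + 1)"
    using trig_add[OF assms(1) trig_1] unfolding trig_def by blast
  from exists_principal_eig[OF this, of "b x0 y0 + 1" lam \<theta>] show ?thesis
    using assms(2) max by simp
qed

lemma exists_fast_growth_rate:
  assumes "\<alpha> > 0"
  shows "\<exists>b\<in>Lambda_xy L1 L2 \<alpha>. \<forall>\<theta>. ereal (real n) \<le> cstar L1 L2 \<theta> b"
proof -
  \<comment> \<open>The target is a square because an admissible speed dominates \<open>lam\<close>,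
    so that only \<open>c\<^sup>2\<close> is bounded below by \<open>lam * c\<close>.\<close>
  obtain b where b: "b \<in> Lambda_xy L1 L2 \<alpha>" "trig b"
    and large: "\<And>lam \<theta> \<mu>. is_principal_eig L1 L2 lam \<theta> b \<mu> \<Longrightarrow> (real n)\<^sup>2 \<le> lam\<^sup>2 - \<mu>"
    using exists_large_eigenvalue[OF assms] by blast
  have nonneg: "b x y \<ge> 0" for x y using b(1) by (simp add: Lambda_xy_def)
  have "real n \<le> c" if "lam > 0" "princ_eig L1 L2 lam \<theta> b = lam\<^sup>2 - lam * c" for c lam \<theta>
  proof -
    obtain \<mu> where \<mu>: "is_principal_eig L1 L2 lam \<theta> b \<mu>"
      using trig_exists_principal_eig[OF b(2) nonneg] by blast
    have eq: "\<mu> = lam\<^sup>2 - lam * c"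
      using princ_eig_eqI[OF L1 L2 \<mu>] that(2) by simp
    have "lam * lam \<le> lam * c"
      using is_principal_eig_nonpos[OF L1 L2 nonneg \<mu>] eq by (simp add: power2_eq_square)
    then have "lam \<le> c" using that(1) by simp
    have "(real n)\<^sup>2 \<le> lam * c" using large[OF \<mu>] eq by simp
    also have "\<dots> \<le> c\<^sup>2" using \<open>lam \<le> c\<close> that(1) by (simp add: power2_eq_square mult_right_mono)
    finally show ?thesis
      by (rule power2_le_imp_le) (use \<open>lam \<le> c\<close> that(1) in linarith)
  qed
  \<comment> \<open>The bound holds for every admissible speed; were there none, the infimum would
    be infinite and the claim still true.\<close>
  then have "ereal (real n) \<le> cstar L1 L2 \<theta> b" for \<theta>
    unfolding cstar_def by (intro Inf_greatest) auto
  then show ?thesis using b(1) by blast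
qed

end

text \<open>Dividing a bound \<open>r \<ge> 0\<close> by a cosine in (0, 1] cannot lower it. The
  competing angle may leave [0, 2 pi), hence the hypothesis on all real directions.\<close>

lemma wspeed_ge:
  assumes "\<And>\<phi>. ereal r \<le> cstar L1 L2 \<phi> b" "r \<ge> 0"
  shows "ereal r \<le> wspeed L1 L2 \<theta> b"
  unfolding wspeed_def
proof (rule Inf_greatest, clarify)
  fix \<phi> assume "\<bar>\<theta> - \<phi>\<bar> < pi / 2"
  then have "0 < cos (\<theta> - \<phi>)" by (intro cos_gt_zero_pi) linarith+
  moreover have "cos (\<theta> - \<phi>) \<le> 1" by simp
  ultimately show "ereal r \<le> cstar L1 L2 \<phi> b / ereal (cos (\<theta> - \<phi>))"
    using assms(1)[of \<phi>] assms(2)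
  proof (cases "cstar L1 L2 \<phi> b")
    case (real c)
    have "r * cos (\<theta> - \<phi>) \<le> r * 1"
      using \<open>cos (\<theta> - \<phi>) \<le> 1\<close> assms(2) by (rule mult_left_mono)
    then show ?thesis
      using real assms(1)[of \<phi>] \<open>0 < cos (\<theta> - \<phi>)\<close> by (simp add: le_divide_eq)
  qed (auto simp: divide_ereal_def)
qed

theorem mainTheorem9:
  fixes L1 L2 \<alpha> :: real
  assumes "L1 > 0" and "L2 > 0" and "\<alpha> > 0"
  shows "\<exists>b :: nat \<Rightarrow> real \<Rightarrow> real \<Rightarrow> real. (\<forall>n. b n \<in> Lambda_xy L1 L2 \<alpha>) \<and>
    (\<forall>\<theta>. 0 \<le> \<theta> \<and> \<theta> < 2 * pi \<longrightarrow>
       ((\<lambda>n. cstar L1 L2 \<theta> (b n)) \<longlonglongrightarrow> \<infinity>) \<and>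
       ((\<lambda>n. wspeed L1 L2 \<theta> (b n)) \<longlonglongrightarrow> \<infinity>))"
proof -
  interpret torus L1 L2 by unfold_locales fact+
  obtain b where b: "\<And>n. b n \<in> Lambda_xy L1 L2 \<alpha>" "\<And>n \<theta>. ereal (real n) \<le> cstar L1 L2 \<theta> (b n)"
    using exists_fast_growth_rate[OF assms(3)] by metis
  have lim: "f \<longlonglongrightarrow> \<infinity>" if "\<And>n. ereal (real n) \<le> f n" for f
  proof -
    have "(\<lambda>n. ereal (real n)) \<longlonglongrightarrow> \<infinity>"
      using filterlim_real_sequentially by (simp add: tendsto_PInfty_eq_at_top)
    then show ?thesis
      by (rule tendsto_sandwich[of "\<lambda>n. ereal (real n)" f _ "\<lambda>_. \<infinity>", rotated 2]) (use that in auto)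
  qed
  have "(\<lambda>n. cstar L1 L2 \<theta> (b n)) \<longlonglongrightarrow> \<infinity>" "(\<lambda>n. wspeed L1 L2 \<theta> (b n)) \<longlonglongrightarrow> \<infinity>" for \<theta>
    by (intro lim b(2) wspeed_ge; simp)+
  then show ?thesis using b(1) by blast
qed

end
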